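(* Let $n_0 \in \mathbb{N}_0$. For each $n \ge n_0$ let $\Theta_n$ be a topological space (equipped with its Borel $\sigma$-algebra), and for each $\theta\in\Theta_n$ let $Y_n$ be, under the law $\mathcal{L}_\theta$, a nonnegative random variable with mean $\mu_{n,\theta}=E_\theta Y_n$ and positive (finite) variance $\sigma_{n,\theta}^2=\operatorname{Var}_\theta(Y_n)$. Set $$W_{n,\theta}=\frac{Y_n-\mu_{n,\theta}}{\sigma_{n,\theta}}.$$ Let $r_{n,\theta}$ be positive for all $n\ge n_0$ and $\theta\in\Theta_n$; assume $\mu_{n,\theta}$, $\sigma^2_{n,\theta}$ and $r_{n,\theta}$ are measurable functions of $\theta\in\Theta_n$. For $r\ge 0$ let $\Theta_{n,r}=\{\theta\in\Theta_n : r_{n,\theta}\ge r\}$. Assume there exist $r_1>0$ and an integer $n_1\ge n_0$ such that $$\max_{n_0\le n<n_1}\ \sup_{\theta\in\Theta_{n,r_1}} r_{n,\theta}<\infty .$$ Suppose further that for all $n\ge n_1$ and $\theta\in\Theta_{n,r_1}$ there exist, on the same probability space as $Y_n$, random variables $Y_n^s, K_n, L_n, \psi_{n,\theta}, V_n, B_n$, and a $\sigma$-algebra $\mathcal{F}_n$ generated by a collection $J_n$ of random elements, such that the following six conditions hold. (1) $Y_n^s$ has the $Y_n$-size bias distribution, and $\Psi_{n,\theta}=\sqrt{\operatorname{Var}_\theta\big(E_\theta(Y_n^s-Y_n\mid Y_n)\big)}$ satisfies $$\sup_{n\ge n_1,\ \theta\in\Theta_{n,r_1}}\frac{r_{n,\theta}\,\mu_{n,\theta}\,\Psi_{n,\theta}}{\sigma_{n,\theta}^2}<\infty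 .$$ (2) $K_n$ is $\mathcal{F}_n$-measurable, $|Y_n^s-Y_n|\le K_n$, and $$\sup_{n\ge n_1,\ \theta\in\Theta_{n,r_1}}\frac{r_{n,\theta}\,\mu_{n,\theta}\,E_\theta[(1+|W_{n,\theta}|)K_n^2]}{\sigma_{n,\theta}^3}<\infty .$$ (3) $L_n$ takes values in $\{0,1,\ldots,n\}$; there are positive integers $s_{n,\theta}$ ($n\ge n_1$, $\theta\in\Theta_{n,r_1}$) with $n-s_{n,\theta}\ge n_0$; $L_n$ and $\psi_{n,\theta}$ are $\mathcal{F}_n$-measurable; and for some event $F_{n,\theta}\in\mathcal{F}_n$ with $F_{n,\theta}\subset\{L_n\le s_{n,\theta}\}$, $$\psi_{n,\theta}\in\Theta_{n-L_n}\quad\text{and}\quad \mathcal{L}_\theta(V_n\mid J_n)=\mathcal{L}_{\psi_{n,\theta}}(Y_{n-L_n})\qquad\text{on } F_{n,\theta},$$ and $$\sup_{n\ge n_1,\ \theta\in\Theta_{n,r_1}}\frac{r_{n,\theta}^2\,\mu_{n,\theta}}{\sigma_{n,\theta}^3}\,E_\theta\big[K_n^2\,(1-\mathbf{1}(F_{n,\theta}))\big]<\infty .$$ (4) There exist constants $c_1,c_2\in(0,\infty)$ (not depending on $n$ or $\theta$) such that $$\sigma_{n,\theta}^2\le c_1\,\sigma^2_{n-L_n,\psi_{n,\theta}}\quad\text{and}\quad r_{n,\theta}\le c_2\, r_{n-L_n,\psi_{n,\theta}}\qquad\text{on } F_{n,\theta}.$$ (5) $B_n$ is $\mathcal{F}_n$-measurable,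 $|Y_n-V_n|\le B_n$, and $$\sup_{n\ge n_1,\ \theta\in\Theta_{n,r_1}}\frac{r_{n,\theta}^2\,\mu_{n,\theta}\,E_\theta[K_n^2B_n]}{\sigma_{n,\theta}^4}<\infty .$$ (6) Either (a) there exists $l_{n,0}\in\{0,\ldots,n\}$ such that $P_\theta(L_n=l_{n,0})=1$ for all $\theta\in\Theta_{n,r_1}$; or (b) the set $\Theta_{n,r_1}$ is a compact subset of $\Theta_n$, and the functions of $\theta$ $$t_{n,\theta,l}=E_\theta\left(\frac{K_n^2}{E_\theta K_n^2}\,\mathbf{1}(L_n=l)\right)$$ are continuous on $\Theta_{n,r_1}$ for each $l\in\{0,1,\ldots,s_n\}$, where $s_n=\sup_{\theta\in\Theta_{n,r_1}}s_{n,\theta}$. Then there exists a constant $C$ such that for all $n\ge n_0$ and all $\theta\in\Theta_n$, $$\sup_{z\in\mathbb{R}}\big|P_\theta(W_{n,\theta}\le z)-P(Z\le z)\big|\le \frac{C}{r_{n,\theta}},$$ where $Z$ is a standard normal random variable.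
   Context: $\mathbb{N}=\{1,2,\ldots\}$ and $\mathbb{N}_0=\mathbb{N}\cup\{0\}$. The framework consists of random elements indexed by $n\ge n_0$ whose distributions $\mathcal{L}_\theta(\cdot)$ depend on $n$ (left implicit) and on a parameter $\theta$ in a topological space $\Theta_n$; $P_\theta,E_\theta,\operatorname{Var}_\theta$ denote probability, expectation and variance under $\mathcal{L}_\theta$. Once $\theta\in\Theta_n$ is fixed, all random variables mentioned (including $Y_n^s,K_n,L_n,\psi_{n,\theta},V_n,B_n$) are considered under $\mathcal{L}_\theta$. Size bias: for a nonnegative random variable $Y$ with finite, nonzero mean $\mu$, a random variable $Y^s$ has the $Y$-size bias distribution if $E[Yf(Y)]=\mu E[f(Y^s)]$ for all functions $f$ for which these expectations exist. In condition (3), $\mathcal{L}_\theta(V_n\mid J_n)$ is the conditional distribution of $V_n$ given $J_n$ (equivalently given $\mathcal{F}_n$). Since $L_n$ and $\psi_{n,\theta}$ are $\mathcal{F}_n$-measurable, the identity $\mathcal{L}_\theta(V_n\mid J_n)=\mathcal{L}_{\psi_{n,\theta}}(Y_{n-L_n})$ on $F_{n,\theta}$ means that on $F_{n,\theta}$, when $L_n=l$ and $\psi_{n,\theta}=\psi$, the conditional law of $V_n$ is the law of $Y_{n-l}$ under parameter $\psi\in\Theta_{n-l}$; the variables $Y_{n_0},\ldots,Y_n$ and $L_n$ need not be defined on a common space for this to make sense. Likewise $\sigma^2_{n-L_n,\psi_{n,\theta}}$ and $r_{n-L_n,\psi_{n,\theta}}$ denote the functions $\sigma^2_{m,\psi}$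 and $r_{m,\psi}$ evaluated at $m=n-L_n$, $\psi=\psi_{n,\theta}$. $\mathbf{1}(\cdot)$ denotes the indicator of an event. *)

theory Defs
  imports "HOL-Probability.Probability"
begin

definition borel_of :: "'t topology \<Rightarrow> 't measure" where
  "borel_of T = sigma (topspace T) {U. openin T U}"

text \<open>The \<open>\<sigma>\<close>-algebra generated by the random elements \<open>J i\<close>, \<open>i \<in> I\<close>, with values in \<open>N i\<close>.\<close>

definition generated_algebra ::
  "'w measure \<Rightarrow> 'i set \<Rightarrow> ('i \<Rightarrow> 'w \<Rightarrow> 'e) \<Rightarrow> ('i \<Rightarrow> 'e measure) \<Rightarrow> 'w measure" where
  "generated_algebra M I J N =
     sigma (space M) (\<Union>i\<in>I. {J i -` A \<inter> space M | A. A \<in> sets (N i)})"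

text \<open>\<open>Ys\<close> has the \<open>Y\<close>-size bias distribution.  The test functions are the Borel functions
  for which both expectations exist.\<close>

definition size_bias :: "'w measure \<Rightarrow> ('w \<Rightarrow> real) \<Rightarrow> ('w \<Rightarrow> real) \<Rightarrow> bool" where
  "size_bias M Y Ys \<longleftrightarrow>
     Y \<in> borel_measurable M \<and> (AE \<omega> in M. 0 \<le> Y \<omega>) \<and>
     integrable M Y \<and> prob_space.expectation M Y \<noteq> 0 \<and>
     Ys \<in> borel_measurable M \<and>
     (\<forall>f :: real \<Rightarrow> real. f \<in> borel_measurable borel \<longrightarrow>
        integrable M (\<lambda>\<omega>. Y \<omega> * f (Y \<omega>)) \<longrightarrow> integrable M (\<lambda>\<omega>. f (Ys \<omega>)) \<longrightarrow>
        prob_space.expectation M (\<lambda>\<omega>. Y \<omega> * f (Y \<omega>)) =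
          prob_space.expectation M Y * prob_space.expectation M (\<lambda>\<omega>. f (Ys \<omega>)))"

text \<open>\<open>E(X | Y)\<close> for a real random variable \<open>Y\<close>.\<close>

definition cond_exp_given ::
  "'w measure \<Rightarrow> ('w \<Rightarrow> real) \<Rightarrow> ('w \<Rightarrow> real) \<Rightarrow> 'w \<Rightarrow> real" where
  "cond_exp_given M Y X = real_cond_exp M (vimage_algebra (space M) Y borel) X"

text \<open>On the event \<open>A\<close>, the conditional distribution of \<open>V\<close> given the sub-\<open>\<sigma>\<close>-algebra \<open>G\<close> is
  the random probability measure \<open>\<nu>\<close>: for every Borel set \<open>B\<close>, \<open>P(V \<in> B | G) = \<nu>(B)\<close> almost
  surely on \<open>A\<close>.\<close>

definition cond_dist_on ::
  "'w measure \<Rightarrow> 'w measure \<Rightarrow> ('w \<Rightarrow> real) \<Rightarrow> 'w set \<Rightarrow> ('w \<Rightarrow> real measure) \<Rightarrow> bool" where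
  "cond_dist_on M G V A \<nu> \<longleftrightarrow>
     (\<forall>B\<in>sets borel. AE \<omega> in M. \<omega> \<in> A \<longrightarrow>
        real_cond_exp M G (\<lambda>\<omega>'. indicator B (V \<omega>')) \<omega> = measure (\<nu> \<omega>) B)"

end

theory Submission
  imports Defs
begin

text \<open>
  Stein's method for the size bias coupling, applied to the indicator of \<open>(-\<infinity>, z]\<close> smoothed
  over a window of length \<open>\<alpha> / r\<close>, bounds the Kolmogorov distance \<open>\<delta>\<close> of \<open>W\<close> to the normal law by
  terms of order \<open>1 / r\<close> plus \<open>\<mu> r / (\<alpha> \<sigma>)\<close> times the integral over \<open>|u| \<le> K / \<sigma>\<close> of
  \<open>E [K / \<sigma>; z \<le> W + u \<le> z + \<alpha> / r]\<close>.  Given \<open>F_n\<close>, the variable \<open>V\<close> is distributed as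
  \<open>Y\<close> at \<open>(n - L, \<psi>)\<close> and lies within \<open>B\<close> of \<open>Y\<close>, so the conditional probability of this event is
  at most the normal one (by the bounds in (4), of the order of the length of the interval) plus
  twice the distance \<open>\<delta>\<close> at \<open>(n - L, \<psi>)\<close>.

  The usual induction on \<open>n\<close> breaks down where \<open>L = 0\<close> has positive probability.  Instead, the
  trivial bound \<open>\<delta> \<le> 1\<close> is improved: if \<open>\<delta> \<le> D / r + \<epsilon>\<close> holds for all \<open>(n, \<theta>)\<close>, then
  so does \<open>\<delta> \<le> D / r + \<epsilon> / 2\<close>, provided that first \<open>\<alpha>\<close> and then \<open>D\<close> are large.  Iteration
  gives \<open>\<delta> \<le> D / r\<close>.
\<close>

subsection \<open>The normal distribution\<close>

text \<open>Near \<open>w\<close> the integral up to \<open>u\<close> is a constant, the integral up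
  to \<open>w - 1\<close>, plus an integral over a compact interval, to which the fundamental
  theorem of calculus applies. Used for \<open>Phi\<close> and for the numerator of the Stein
  solution.\<close>

lemma integral_atMost_has_real_derivative:
  fixes k :: "real \<Rightarrow> real"
  assumes int: "integrable lborel k" and cont: "continuous_on UNIV k"
  shows "((\<lambda>w. \<integral>x. indicator {..w} x * k x \<partial>lborel) has_real_derivative k w) (at w)"
proof -
  let ?A = "\<lambda>w. \<integral>x. indicator {..w} x * k x \<partial>lborel"
  have A_eq: "?A u = ?A (w - 1) + integral {w - 1..u} k" if "w - 1 \<le> u" for u
  proof -
    have [simp]: "k \<in> borel_measurable lborel" using int by auto
    have i1: "integrable lborel (\<lambda>x. indicator {..w-1} x * k x)"
      "integrable lborel (\<lambda>x. indicator {w-1..u} x * k x)"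
      using integrable_mult_indicator[OF _ int] by auto
    have "?A u = (\<integral>x. indicator {..w-1} x * k x + indicator {w-1..u} x * k x \<partial>lborel)"
    proof (rule integral_cong_AE)
      \<comment> \<open>Almost everywhere only: the two sets on the right share the point
        \<open>w - 1\<close>.\<close>
      show "AE x in lborel. indicator {..u} x * k x
          = indicator {..w-1} x * k x + indicator {w-1..u} x * k x"
        using AE_lborel_singleton[of "w-1"] by eventually_elim (use that in \<open>auto simp: indicator_def\<close>)
    qed (use borel_measurable_continuous_onI[OF cont] in measurable)
    also have "\<dots> = ?A (w - 1) + (\<integral>x. indicator {w-1..u} x * k x \<partial>lborel)"
      using i1 by simp
    also have "(\<integral>x. indicator {w-1..u} x * k x \<partial>lborel) = integral {w-1..u} k"
      using set_borel_integral_eq_integral(2)[of "{w-1..u}" k] i1(2)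
      by (simp add: set_lebesgue_integral_def set_integrable_def)
    finally show ?thesis .
  qed
  have "((\<lambda>u. integral {w-1..u} k) has_real_derivative k w) (at w within {w-1..w+1})"
    by (rule integral_has_real_derivative)
       (auto intro: continuous_on_subset[OF cont])
  then have "((\<lambda>u. ?A (w - 1) + integral {w-1..u} k) has_real_derivative k w) (at w within {w-1..w+1})"
    by (auto intro!: derivative_eq_intros)
  then have "((\<lambda>u. ?A (w - 1) + integral {w-1..u} k) has_real_derivative k w) (at w)"
    by (subst (asm) at_within_interior) auto
  then show ?thesis
  proof (rule has_field_derivative_transform_within[where d=1])
    fix u assume "dist u w < 1"
    then show "?A (w - 1) + integral {w-1..u} k = ?A u"
      by (intro A_eq[symmetric]) (auto simp: dist_real_def)
  qed auto
qed

abbreviation (input) Phi :: "real \<Rightarrow> real" where "Phi \<equiv> cdf std_normal_distribution"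

lemma Phi_eq: "Phi w = (\<integral>x. indicator {..w} x * std_normal_density x \<partial>lborel)"
proof -
  interpret real_distribution std_normal_distribution by (rule real_dist_normal_dist)
  have "Phi w = (\<integral>x. indicator {..w} x \<partial>std_normal_distribution)"
    by (simp add: cdf_def)
  also have "\<dots> = (\<integral>x. std_normal_density x *\<^sub>R indicator {..w} x \<partial>lborel)"
    by (rule integral_density) auto
  finally show ?thesis by (simp add: mult.commute)
qed

lemma continuous_std_normal_density: "continuous_on UNIV std_normal_density"
  unfolding std_normal_density_def by (intro continuous_intros) auto

lemma integrable_std_normal_density: "integrable lborel std_normal_density"
  by simp

lemma DERIV_Phi: "(Phi has_real_derivative std_normal_density w) (at w)"
  using integral_atMost_has_real_derivative[OF integrable_std_normal_density continuous_std_normal_density, of w]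
  unfolding Phi_eq .

lemma std_normal_density_positive: "0 < std_normal_density x"
  by (simp add: normal_density_pos)

lemma std_normal_density_le_1: "std_normal_density x \<le> 1"
proof -
  have "1 \<le> sqrt (2 * pi)" using pi_ge_two by auto
  moreover have "exp (- x\<^sup>2 / 2) \<le> 1" by simp
  ultimately show ?thesis unfolding std_normal_density_def
    by (smt (verit) divide_le_eq_1 mult_cancel_right1 times_divide_eq_left)
qed

text \<open>The density is at most 1, so \<open>x - Phi x\<close> is nondecreasing. This Lipschitz
  constant 1 is the only fact about normal interval probabilities that the later estimates
  use.\<close>

lemma Phi_diff_le: assumes "p \<le> q" shows "Phi q - Phi p \<le> q - p"
proof -
  have "(\<lambda>x. x - Phi x) p \<le> (\<lambda>x. x - Phi x) q"
    by (rule DERIV_nonneg_imp_nondecreasing[OF assms])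
       (auto intro!: derivative_eq_intros exI DERIV_Phi simp: std_normal_density_le_1)
  then show ?thesis by simp
qed

lemma DERIV_std_normal_density:
  "(std_normal_density has_real_derivative (- x * std_normal_density x)) (at x)"
  unfolding std_normal_density_def[abs_def] by (auto intro!: derivative_eq_intros simp: field_simps)

lemma std_normal_density_minus: "std_normal_density (- x) = std_normal_density x"
  by (simp add: std_normal_density_def)

lemma Phi_minus: "Phi (- w) = 1 - Phi w"
proof -
  have "Phi (- w) = (\<integral>x. indicator {..-w} (-x) * std_normal_density x \<partial>lborel)"
    unfolding Phi_eq by (subst lborel_integral_real_affine[where c="-1" and t=0])
      (auto simp: std_normal_density_minus)
  also have "\<dots> = (\<integral>x. std_normal_density x - indicator {..w} x * std_normal_density x \<partial>lborel)"
  proof (rule integral_cong_AE)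
    show "AE x in lborel. indicator {..- w} (- x) * std_normal_density x
        = std_normal_density x - indicator {..w} x * std_normal_density x"
      using AE_lborel_singleton[of w] by eventually_elim (auto simp: indicator_def)
  qed auto
  also have "\<dots> = 1 - Phi w"
    unfolding Phi_eq using integrable_mult_indicator[OF _ integrable_std_normal_density, of "{..w}"]
    by (subst Bochner_Integration.integral_diff) auto
  finally show ?thesis .
qed

lemma Phi_nonneg: "0 \<le> Phi w" and Phi_le_1: "Phi w \<le> 1"
proof -
  interpret real_distribution std_normal_distribution by (rule real_dist_normal_dist)
  show "0 \<le> Phi w" "Phi w \<le> 1" by (auto simp: cdf_nonneg cdf_bounded_prob)
qed

text \<open>The function \<open>?v\<close> has derivative
  \<open>(w - y) * std_normal_density y\<close>, so it is nondecreasing up to \<open>w\<close>. It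
  also dominates \<open>w * Phi x\<close>, which tends to 0 as x tends to minus infinity; hence
  \<open>?v w\<close> is nonnegative.\<close>

lemma Mills_ratio_left:
  assumes "w < 0" shows "- w * Phi w \<le> std_normal_density w"
proof -
  interpret real_distribution std_normal_distribution by (rule real_dist_normal_dist)
  let ?v = "\<lambda>x. std_normal_density x + w * Phi x"
  have mono: "?v x \<le> ?v w" if "x \<le> w" for x
  proof (rule DERIV_nonneg_imp_nondecreasing[OF that])
    fix y assume "x \<le> y" "y \<le> w"
    have "(?v has_real_derivative (- y * std_normal_density y + w * std_normal_density y)) (at y)"
      by (auto intro!: derivative_eq_intros DERIV_Phi DERIV_std_normal_density)
    moreover have "0 \<le> (w - y) * std_normal_density y"
      using \<open>y \<le> w\<close> by (intro mult_nonneg_nonneg) auto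
    ultimately show "\<exists>d. (?v has_real_derivative d) (at y) \<and> 0 \<le> d"
      by (auto simp: algebra_simps)
  qed
  have "((\<lambda>x. w * Phi x) \<longlongrightarrow> w * 0) at_bot"
    by (intro tendsto_intros cdf_lim_at_bot)
  moreover have "w * Phi x \<le> ?v w" if "x \<le> w" for x
    using mono[OF that] std_normal_density_positive[of x] by linarith
  then have "eventually (\<lambda>x. w * Phi x \<le> ?v w) at_bot"
    by (auto simp: eventually_at_bot_linorder)
  ultimately have "w * 0 \<le> ?v w" by (rule tendsto_upperbound) auto
  then show ?thesis by simp
qed

text \<open>This is the source of the constant 6 in the bound on Stein solutions: the root of 2 pi
  is at most 3 and the root of e at most 2.\<close>

lemma std_normal_density_1_ge: "1 / 6 \<le> std_normal_density 1"
proof -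
  have "sqrt (2 * pi) \<le> 3" using pi_less_4 by (intro real_le_lsqrt) auto
  moreover have "exp (1/2::real) \<le> 2"
    using exp_le by (smt (verit) exp_half_le2)
  ultimately have "sqrt (2 * pi) * exp (1/2) \<le> 3 * 2"
    by (intro mult_mono) auto
  then have "1 / (3 * 2) \<le> 1 / (sqrt (2 * pi) * exp (1/2))"
    by (intro divide_left_mono) auto
  then show ?thesis by (simp add: std_normal_density_def exp_minus field_simps)
qed

text \<open>The second bound is the Mills ratio. It implies the first for |w| at least 1; for
  smaller |w| the density is at least its value at 1, while \<open>Phi\<close> is at most 1.
  Together they control both f and w f for a Stein solution f.\<close>

lemma Phi_tail_le: "Phi (- \<bar>w\<bar>) \<le> 6 * std_normal_density w"
  and Phi_tail_le': "\<bar>w\<bar> * Phi (- \<bar>w\<bar>) \<le> std_normal_density w"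
proof -
  have eq: "std_normal_density w = std_normal_density (- \<bar>w\<bar>)"
    by (simp add: std_normal_density_def)
  show *: "\<bar>w\<bar> * Phi (- \<bar>w\<bar>) \<le> std_normal_density w"
    using Mills_ratio_left[of "-\<bar>w\<bar>"] by (cases "w = 0") (auto simp flip: eq)
  show "Phi (- \<bar>w\<bar>) \<le> 6 * std_normal_density w"
  proof (cases "\<bar>w\<bar> \<ge> 1")
    case True
    then have "Phi (- \<bar>w\<bar>) \<le> \<bar>w\<bar> * Phi (- \<bar>w\<bar>)"
      using Phi_nonneg[of "- \<bar>w\<bar>"] mult_right_mono[of 1 "\<bar>w\<bar>"] by auto
    with * show ?thesis using std_normal_density_positive[of w] by linarith
  next
    case False
    then have "w\<^sup>2 \<le> 1" by (simp add: abs_square_le_1)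
    then have "std_normal_density 1 \<le> std_normal_density w"
      unfolding std_normal_density_def by (intro mult_left_mono) auto
    with std_normal_density_1_ge Phi_le_1[of "- \<bar>w\<bar>"] show ?thesis by linarith
  qed
qed

subsection \<open>Stein's equation\<close>

text \<open>The solution is the integral of \<open>(h x - m) * std_normal_density x\<close> up to
  \<open>w\<close>, divided by the density at \<open>w\<close>. As the total integral vanishes, the
  numerator is bounded by the smaller of the two normal tails, \<open>Phi (- \<bar>w\<bar>)\<close>.
  The tail estimates then give |f| at most 6 and |w f| at most 1; with |h - m| at most 1 this bounds
  the derivative by 2.\<close>

lemma Stein_equation_solution:
  fixes h :: "real \<Rightarrow> real"
  assumes cont: "continuous_on UNIV h" and h: "\<And>x. 0 \<le> h x" "\<And>x. h x \<le> 1"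
  defines "m \<equiv> \<integral>x. h x * std_normal_density x \<partial>lborel"
  obtains f :: "real \<Rightarrow> real" where
    "\<And>w. (f has_real_derivative (w * f w + h w - m)) (at w)"
    "\<And>w. \<bar>f w\<bar> \<le> 6" "\<And>w. \<bar>w * f w + h w - m\<bar> \<le> 2"
proof -
  have hm[measurable]: "h \<in> borel_measurable borel" using cont by (rule borel_measurable_continuous_onI)
  have inth: "integrable lborel (\<lambda>x. h x * std_normal_density x)"
    by (rule Bochner_Integration.integrable_bound[OF integrable_std_normal_density])
       (use h in \<open>auto simp: abs_mult intro!: mult_left_le_one_le\<close>)
  have "m \<le> (\<integral>x. std_normal_density x \<partial>lborel)"
    unfolding m_def by (intro integral_mono inth integrable_std_normal_density)
      (use h in \<open>auto intro!: mult_left_le_one_le\<close>)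
  then have m1: "m \<le> 1" by simp
  have m0: "0 \<le> m" unfolding m_def by (intro integral_nonneg_AE) (auto simp: h)
  have g1: "\<bar>h x - m\<bar> \<le> 1" for x using h[of x] m0 m1 by auto
  let ?k = "\<lambda>x. (h x - m) * std_normal_density x"
  have intk: "integrable lborel ?k"
    using inth integrable_std_normal_density by (simp add: left_diff_distrib)
  have contk: "continuous_on UNIV ?k"
    by (intro continuous_intros cont continuous_std_normal_density)
  have k0: "(\<integral>x. ?k x \<partial>lborel) = 0"
    using inth integrable_std_normal_density
    by (simp add: left_diff_distrib m_def)
  define A where "A w = (\<integral>x. indicator {..w} x * ?k x \<partial>lborel)" for w
  have kle: "\<bar>?k x\<bar> \<le> std_normal_density x" for x
    using mult_right_mono[OF g1, of "std_normal_density x" x] by (simp add: abs_mult)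
  have intAk: "integrable lborel (\<lambda>x. indicator {..w} x * ?k x)" for w
    using integrable_mult_indicator[OF _ intk, of "{..w}"] by simp
  have intAp: "integrable lborel (\<lambda>x. indicator {..w} x * std_normal_density x)" for w
    using integrable_mult_indicator[OF _ integrable_std_normal_density, of "{..w}"] by simp
  have A1: "\<bar>A w\<bar> \<le> Phi w" for w
  proof -
    have "\<bar>A w\<bar> \<le> (\<integral>x. \<bar>indicator {..w} x * ?k x\<bar> \<partial>lborel)"
      unfolding A_def by (rule integral_abs_bound)
    also have "\<dots> \<le> Phi w" unfolding Phi_eq
      by (intro integral_mono integrable_abs intAk intAp)
         (use kle in \<open>auto simp: indicator_def\<close>)
    finally show ?thesis .
  qed
  \<comment> \<open>Since \<open>?k\<close> has total integral 0, the left integral is minus the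
    right one, which is at most the upper normal tail.\<close>
  have A2: "\<bar>A w\<bar> \<le> 1 - Phi w" for w
  proof -
    have "A w = - (\<integral>x. ?k x - indicator {..w} x * ?k x \<partial>lborel)"
      using intk intAk k0 by (simp add: A_def)
    then have "\<bar>A w\<bar> \<le> (\<integral>x. \<bar>?k x - indicator {..w} x * ?k x\<bar> \<partial>lborel)"
      using integral_abs_bound[of lborel "\<lambda>x. ?k x - indicator {..w} x * ?k x"] by simp
    also have "\<dots> \<le> (\<integral>x. std_normal_density x - indicator {..w} x * std_normal_density x \<partial>lborel)"
      by (intro integral_mono integrable_abs Bochner_Integration.integrable_diff intAk intAp intk integrable_std_normal_density)
         (use kle in \<open>auto simp: indicator_def\<close>)
    also have "\<dots> = 1 - Phi w"
      using intAp by (simp add: Phi_eq)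
    finally show ?thesis .
  qed
  have A3: "\<bar>A w\<bar> \<le> Phi (- \<bar>w\<bar>)" for w
    using A1[of w] A2[of w] Phi_minus[of w] by (cases "w \<ge> 0") auto
  have pos: "std_normal_density w > 0" for w by (rule std_normal_density_positive)
  have DA: "(A has_real_derivative ?k w) (at w)" for w
    unfolding A_def[abs_def] by (rule integral_atMost_has_real_derivative[OF intk contk])
  define f where "f w = A w / std_normal_density w" for w
  have D: "(f has_real_derivative (w * f w + h w - m)) (at w)" for w
  proof -
    have "(f has_real_derivative ((?k w * std_normal_density w - A w * (- w * std_normal_density w))
        / (std_normal_density w * std_normal_density w))) (at w)"
      unfolding f_def[abs_def] using pos[of w]
      by (intro DERIV_divide DA DERIV_std_normal_density) auto
    also have "((?k w * std_normal_density w - A w * (- w * std_normal_density w))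
        / (std_normal_density w * std_normal_density w)) = w * f w + h w - m"
      using pos[of w] by (simp add: f_def field_simps)
    finally show ?thesis .
  qed
  have f6: "\<bar>f w\<bar> \<le> 6" for w
    using A3[of w] Phi_tail_le[of w] pos[of w] by (simp add: f_def abs_mult divide_le_eq)
  have "\<bar>w * f w\<bar> \<le> 1" for w
  proof -
    have "\<bar>w\<bar> * \<bar>A w\<bar> \<le> \<bar>w\<bar> * Phi (- \<bar>w\<bar>)" by (intro mult_left_mono A3) auto
    then show ?thesis using Phi_tail_le'[of w] pos[of w] by (simp add: f_def abs_mult divide_le_eq)
  qed
  then have "\<bar>w * f w + h w - m\<bar> \<le> 2" for w
    using g1[of w] abs_triangle_ineq[of "w * f w" "h w - m"] by (smt (verit))
  with D f6 show ?thesis by (rule that)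
qed

subsection \<open>The size bias coupling\<close>

text \<open>Nonnegativity of the variance of |X|.\<close>

lemma (in prob_space) integral_abs_le_sqrt:
  fixes X :: "'a \<Rightarrow> real"
  assumes [measurable]: "X \<in> borel_measurable M" and "integrable M (\<lambda>\<omega>. (X \<omega>)\<^sup>2)"
  shows "(\<integral>\<omega>. \<bar>X \<omega>\<bar> \<partial>M) \<le> sqrt (\<integral>\<omega>. (X \<omega>)\<^sup>2 \<partial>M)"
proof -
  have i: "integrable M (\<lambda>\<omega>. \<bar>X \<omega>\<bar>)"
    by (rule square_integrable_imp_integrable) (use assms in auto)
  have "0 \<le> variance (\<lambda>\<omega>. \<bar>X \<omega>\<bar>)" by (rule variance_positive)
  also have "\<dots> = (\<integral>\<omega>. (X \<omega>)\<^sup>2 \<partial>M) - (\<integral>\<omega>. \<bar>X \<omega>\<bar> \<partial>M)\<^sup>2"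
    using i assms by (subst variance_eq) auto
  finally show ?thesis by (intro real_le_rsqrt) simp
qed

text \<open>Because \<open>g (Y \<omega>)\<close> is measurable with respect to the \<sigma>-algebra
  of \<open>Y\<close>, the variable \<open>X\<close> may be replaced by its conditional expectation
  given \<open>Y\<close>, which has the same mean. What remains is a bounded factor times a centered
  variable, whose first absolute moment is at most its standard deviation. This is how the quantity
  of condition (1) enters.\<close>

lemma (in prob_space) integral_mult_centered_le:
  fixes X Y :: "'a \<Rightarrow> real" and g :: "real \<Rightarrow> real"
  assumes [measurable]: "X \<in> borel_measurable M" "Y \<in> borel_measurable M" "g \<in> borel_measurable borel"
    and X2: "integrable M (\<lambda>\<omega>. (X \<omega>)\<^sup>2)" and g: "\<And>y. \<bar>g y\<bar> \<le> c"
  shows "\<bar>\<integral>\<omega>. g (Y \<omega>) * (X \<omega> - expectation X) \<partial>M\<bar> \<le> c * sqrt (variance (cond_exp_given M Y X))"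
proof -
  let ?F = "vimage_algebra (space M) Y borel"
  define Z where "Z = cond_exp_given M Y X"
  have sub: "subalgebra M ?F"
    unfolding subalgebra_def by (auto intro!: sets_vimage_algebra_space measurable_sets simp: sets_vimage_algebra2)
  interpret finite_measure_subalgebra M ?F
    by unfold_locales (rule sub)
  have [measurable]: "Y \<in> measurable ?F borel" by (rule measurable_vimage_algebra1) auto
  have c0: "0 \<le> c" using g[of 0] by linarith
  have iX: "integrable M X" by (rule square_integrable_imp_integrable[OF _ X2]) auto
  have iZ: "integrable M Z" and EZ: "expectation Z = expectation X"
    unfolding Z_def cond_exp_given_def using real_cond_exp_int[OF iX] by auto
  have igX: "integrable M (\<lambda>\<omega>. g (Y \<omega>) * X \<omega>)"
    by (rule Bochner_Integration.integrable_bound[OF integrable_mult_right[OF iX, of c]])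
      (use g c0 in \<open>auto simp: abs_mult intro!: mult_mono\<close>)
  have igZ: "integrable M (\<lambda>\<omega>. g (Y \<omega>) * Z \<omega>)"
    and gZ: "(\<integral>\<omega>. g (Y \<omega>) * Z \<omega> \<partial>M) = (\<integral>\<omega>. g (Y \<omega>) * X \<omega> \<partial>M)"
    unfolding Z_def cond_exp_given_def using real_cond_exp_intg[OF igX] by auto
  have ig: "integrable M (\<lambda>\<omega>. g (Y \<omega>))"
    by (rule integrable_const_bound[where B=c]) (use g in auto)
  \<comment> \<open>Conditional Jensen inequality for the square. Integrability matters here: the
    variance is a Bochner integral, which would have the default value 0 if the integrand were not
    integrable.\<close>
  have Z2: "integrable M (\<lambda>\<omega>. (Z \<omega>)\<^sup>2)"
    unfolding Z_def cond_exp_given_def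
    by (rule integrable_convex_cond_exp[where I=UNIV]) (use iX X2 convex_power2 in auto)
  have [measurable]: "Z \<in> borel_measurable M" using iZ by auto
  have iZc2: "integrable M (\<lambda>\<omega>. (Z \<omega> - expectation Z)\<^sup>2)"
    using iZ Z2 by (auto simp: power2_diff)
  have "(\<integral>\<omega>. g (Y \<omega>) * (X \<omega> - expectation X) \<partial>M) = (\<integral>\<omega>. g (Y \<omega>) * (Z \<omega> - expectation Z) \<partial>M)"
    using igX igZ ig gZ by (simp add: right_diff_distrib EZ)
  also have "\<bar>\<dots>\<bar> \<le> (\<integral>\<omega>. \<bar>g (Y \<omega>) * (Z \<omega> - expectation Z)\<bar> \<partial>M)"
    by (rule integral_abs_bound)
  also have "\<dots> \<le> (\<integral>\<omega>. c * \<bar>Z \<omega> - expectation Z\<bar> \<partial>M)"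
  proof (intro integral_mono integrable_abs integrable_mult_right)
    show "integrable M (\<lambda>\<omega>. g (Y \<omega>) * (Z \<omega> - expectation Z))"
      unfolding right_diff_distrib using igZ ig by simp
  qed (use iZ g in \<open>auto simp: abs_mult intro!: mult_right_mono\<close>)
  also have "\<dots> = c * (\<integral>\<omega>. \<bar>Z \<omega> - expectation Z\<bar> \<partial>M)" by simp
  also have "\<dots> \<le> c * sqrt (variance Z)"
    by (intro mult_left_mono integral_abs_le_sqrt iZc2 c0) auto
  finally show ?thesis unfolding Z_def .
qed

section \<open>Smoothed indicators and their Stein solutions\<close>

definition ramp :: "real \<Rightarrow> real \<Rightarrow> real \<Rightarrow> real" where
  "ramp z l w = max 0 (min 1 ((z + l - w) / l))"

text \<open>The length of the intersection of [-k, k] and [a, b], in closed form so that increments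
  of \<open>ramp\<close> can be estimated by linear arithmetic; \<open>emeasure_overlap\<close>
  recovers the measure.\<close>

definition overlap :: "real \<Rightarrow> real \<Rightarrow> real \<Rightarrow> real" where
  "overlap k a b = max 0 (min k b - max (- k) a)"

lemma continuous_on_ramp: "l > 0 \<Longrightarrow> continuous_on A (ramp z l)"
  unfolding ramp_def by (intro continuous_intros) auto

lemma ramp_bounds: "0 \<le> ramp z l w" "ramp z l w \<le> 1"
  by (auto simp: ramp_def)

lemma ramp_eq_1: "0 < l \<Longrightarrow> w \<le> z \<Longrightarrow> ramp z l w = 1"
  and ramp_eq_0: "0 < l \<Longrightarrow> z + l \<le> w \<Longrightarrow> ramp z l w = 0"
  by (auto simp: ramp_def field_simps)

text \<open>The ramp falls from 1 at z to 0 at z + l with slope -1/l and is constant elsewhere.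
  Between w and w + t it therefore changes by at most 1/l times the length of the part of [z, z + l]
  within distance k of w.\<close>

lemma ramp_increment:
  assumes l: "0 < l" and t: "\<bar>t\<bar> \<le> k"
  shows "\<bar>ramp z l (w + t) - ramp z l w\<bar> \<le> overlap k (z - w) (z + l - w) / l"
proof -
  have eq: "l * ramp z l x = max 0 (min l (z + l - x))" for x
    using l by (auto simp: ramp_def max_def min_def field_simps)
  have "\<bar>l * ramp z l (w + t) - l * ramp z l w\<bar> \<le> overlap k (z - w) (z + l - w)"
    unfolding eq overlap_def max_def min_def using l t by (smt (verit))
  moreover have "\<bar>l * ramp z l (w + t) - l * ramp z l w\<bar> = \<bar>ramp z l (w + t) - ramp z l w\<bar> * l"
    using l by (metis abs_mult abs_of_pos mult.commute right_diff_distrib)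
  ultimately show ?thesis using l by (simp only: pos_le_divide_eq)
qed

text \<open>By the mean value theorem the remainder is d times an increment of \<open>f'\<close>
  over some t with |t| at most |d|. Stein's equation, rather than a second derivative, gives this
  increment as t f(w + t) + w (f(w + t) - f(w)) plus an increment of the ramp. The three parts are
  at most 6 k, 2 k |w| and the overlap divided by l.\<close>

lemma Stein_ramp_solution:
  assumes l: "0 < l"
  obtains f f' :: "real \<Rightarrow> real" where
    "f \<in> borel_measurable borel" "f' \<in> borel_measurable borel"
    "\<And>w. \<bar>f w\<bar> \<le> 6" "\<And>w. \<bar>f' w\<bar> \<le> 2"
    "\<And>w. f' w - w * f w = ramp z l w - (\<integral>x. ramp z l x * std_normal_density x \<partial>lborel)"
    "\<And>w d k. \<bar>d\<bar> \<le> k \<Longrightarrow> \<bar>f (w + d) - f w - d * f' w\<bar>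
        \<le> k * (6 * (1 + \<bar>w\<bar>) * k + overlap k (z - w) (z + l - w) / l)"
proof -
  define m where "m = (\<integral>x. ramp z l x * std_normal_density x \<partial>lborel)"
  obtain f where D: "\<And>w. (f has_real_derivative (w * f w + ramp z l w - m)) (at w)"
    and f6: "\<And>w. \<bar>f w\<bar> \<le> 6" and f2: "\<And>w. \<bar>w * f w + ramp z l w - m\<bar> \<le> 2"
    unfolding m_def by (rule Stein_equation_solution[OF continuous_on_ramp[OF l, of _ z] ramp_bounds]) blast
  define f' where "f' w = w * f w + ramp z l w - m" for w
  have cf: "continuous_on UNIV f"
    using D by (meson DERIV_isCont continuous_at_imp_continuous_on)
  have [measurable]: "f \<in> borel_measurable borel" by (rule borel_measurable_continuous_onI[OF cf])
  have [measurable]: "f' \<in> borel_measurable borel" unfolding f'_def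
    by (intro borel_measurable_continuous_onI continuous_intros cf continuous_on_ramp[OF l])
  have MVT: "\<exists>t. \<bar>t\<bar> \<le> \<bar>d\<bar> \<and> f (w + d) - f w = d * f' (w + t)" for w d
  proof (cases d "0::real" rule: linorder_cases)
    case less
    then obtain y where "w + d < y" "y < w" "f w - f (w + d) = (w - (w + d)) * f' y"
      using MVT2[of "w + d" w f f'] D f'_def by auto
    then show ?thesis by (intro exI[of _ "y - w"]) auto
  next
    case greater
    then obtain y where "w < y" "y < w + d" "f (w + d) - f w = (w + d - w) * f' y"
      using MVT2[of w "w + d" f f'] D f'_def by auto
    then show ?thesis by (intro exI[of _ "y - w"]) auto
  qed auto
  show ?thesis
  proof (rule that[of f f'])
    fix w d k :: real assume d: "\<bar>d\<bar> \<le> k"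
    then have k0: "0 \<le> k" by auto
    obtain t where t: "\<bar>t\<bar> \<le> \<bar>d\<bar>" and ft: "f (w + d) - f w = d * f' (w + t)" using MVT by blast
    obtain u where "f (w + t) - f w = t * f' (w + u)" using MVT by blast
    then have "\<bar>f (w + t) - f w\<bar> \<le> \<bar>t\<bar> * 2"
      using f2[of "w + u"] by (simp add: abs_mult mult_left_mono f'_def)
    then have a: "\<bar>w * (f (w + t) - f w)\<bar> \<le> \<bar>w\<bar> * (k * 2)"
      unfolding abs_mult by (intro mult_left_mono) (use t d in auto)
    have b: "\<bar>t * f (w + t)\<bar> \<le> k * 6"
      unfolding abs_mult by (intro mult_mono f6) (use t d k0 in auto)
    have c: "\<bar>ramp z l (w + t) - ramp z l w\<bar> \<le> overlap k (z - w) (z + l - w) / l"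
      by (rule ramp_increment[OF l]) (use t d in auto)
    have "f' (w + t) - f' w = t * f (w + t) + w * (f (w + t) - f w) + (ramp z l (w + t) - ramp z l w)"
      by (simp add: f'_def algebra_simps)
    also have "\<bar>\<dots>\<bar> \<le> k * 6 + \<bar>w\<bar> * (k * 2) + overlap k (z - w) (z + l - w) / l"
      using a b c by linarith
    also have "\<dots> \<le> 6 * (1 + \<bar>w\<bar>) * k + overlap k (z - w) (z + l - w) / l"
      using k0 by (simp add: algebra_simps)
    finally have *: "\<bar>f' (w + t) - f' w\<bar> \<le> \<dots>" .
    have "f (w + d) - f w - d * f' w = d * (f' (w + t) - f' w)" using ft by (simp add: right_diff_distrib)
    also have "\<bar>\<dots>\<bar> \<le> k * (6 * (1 + \<bar>w\<bar>) * k + overlap k (z - w) (z + l - w) / l)"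
      unfolding abs_mult by (intro mult_mono d *) (use k0 in auto)
    finally show "\<bar>f (w + d) - f w - d * f' w\<bar>
        \<le> k * (6 * (1 + \<bar>w\<bar>) * k + overlap k (z - w) (z + l - w) / l)" .
  qed (use f6 f2 in \<open>auto simp: f'_def m_def\<close>)
qed

text \<open>Put g(y) = f((y - \<mu>) / \<sigma>) for the Stein solution f. The size bias identity
  turns E[W f(W)] into \<mu>/\<sigma> times E[g(Ys) - g(Y)]. Expanding to first order in X = Ys - Y,
  the linear part combines with E f'(W) to a multiple of the covariance of f'(W) and X, which gives
  the first term of the bound; the remainder gives the other two.\<close>

lemma (in prob_space) size_bias_Stein_bound:
  fixes Y Ys K :: "'a \<Rightarrow> real"
  defines "\<mu> \<equiv> expectation Y" and "\<sigma> \<equiv> sqrt (variance Y)"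
  defines "W \<equiv> \<lambda>\<omega>. (Y \<omega> - \<mu>) / \<sigma>"
  assumes sb: "size_bias M Y Ys"
    and Y2: "integrable M (\<lambda>\<omega>. (Y \<omega>)\<^sup>2)" and var: "0 < variance Y"
    and [measurable]: "K \<in> borel_measurable M"
    and K: "AE \<omega> in M. \<bar>Ys \<omega> - Y \<omega>\<bar> \<le> K \<omega>"
    and K2: "integrable M (\<lambda>\<omega>. (1 + \<bar>W \<omega>\<bar>) * (K \<omega>)\<^sup>2)"
    and l: "0 < l"
  shows "integrable M (\<lambda>\<omega>. K \<omega> / \<sigma> * overlap (K \<omega> / \<sigma>) (z - W \<omega>) (z + l - W \<omega>))"
    and "\<bar>(\<integral>\<omega>. ramp z l (W \<omega>) \<partial>M) - (\<integral>x. ramp z l x * std_normal_density x \<partial>lborel)\<bar>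
      \<le> 2 * \<mu> / \<sigma>\<^sup>2 * sqrt (variance (cond_exp_given M Y (\<lambda>\<omega>. Ys \<omega> - Y \<omega>)))
        + 6 * \<mu> / \<sigma>^3 * (\<integral>\<omega>. (1 + \<bar>W \<omega>\<bar>) * (K \<omega>)\<^sup>2 \<partial>M)
        + \<mu> / (\<sigma> * l) * (\<integral>\<omega>. K \<omega> / \<sigma> * overlap (K \<omega> / \<sigma>) (z - W \<omega>) (z + l - W \<omega>) \<partial>M)"
proof -
  have [measurable]: "Y \<in> borel_measurable M" "Ys \<in> borel_measurable M"
    and Y0: "AE \<omega> in M. 0 \<le> Y \<omega>" and iY: "integrable M Y" and "\<mu> \<noteq> 0"
    using sb by (auto simp: size_bias_def \<mu>_def)
  have sbf: "expectation (\<lambda>\<omega>. Y \<omega> * g (Y \<omega>)) = \<mu> * expectation (\<lambda>\<omega>. g (Ys \<omega>))"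
    if "g \<in> borel_measurable borel" "integrable M (\<lambda>\<omega>. Y \<omega> * g (Y \<omega>))" "integrable M (\<lambda>\<omega>. g (Ys \<omega>))"
    for g :: "real \<Rightarrow> real"
    using sb that by (auto simp: size_bias_def \<mu>_def)
  have "0 \<le> \<mu>" unfolding \<mu>_def by (rule integral_nonneg_AE[OF Y0])
  with \<open>\<mu> \<noteq> 0\<close> have \<mu>: "0 < \<mu>" by simp
  have \<sigma>: "0 < \<sigma>" using var by (simp add: \<sigma>_def)
  have \<sigma>2: "\<sigma>\<^sup>2 = variance Y" using var by (simp add: \<sigma>_def)
  have [measurable]: "W \<in> borel_measurable M" unfolding W_def by measurable
  have iK2: "integrable M (\<lambda>\<omega>. (K \<omega>)\<^sup>2)"
    by (rule Bochner_Integration.integrable_bound[OF K2])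
      (auto simp: abs_mult intro!: AE_I2 mult_le_cancel_right2[THEN iffD2] simp: distrib_right)
  have iK: "integrable M K" by (rule square_integrable_imp_integrable[OF _ iK2]) auto
  define X where "X \<omega> = Ys \<omega> - Y \<omega>" for \<omega>
  have [measurable]: "X \<in> borel_measurable M" unfolding X_def by measurable
  have XK: "AE \<omega> in M. \<bar>X \<omega>\<bar> \<le> K \<omega>" using K by (simp add: X_def)
  have iX: "integrable M X"
    by (rule Bochner_Integration.integrable_bound[OF iK]) (use XK in auto)
  have iX2: "integrable M (\<lambda>\<omega>. (X \<omega>)\<^sup>2)"
  proof (rule Bochner_Integration.integrable_bound[OF iK2])
    show "AE \<omega> in M. norm ((X \<omega>)\<^sup>2) \<le> norm ((K \<omega>)\<^sup>2)"
      using XK by eventually_elim (auto intro!: power2_le_iff_abs_le[THEN iffD2])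
  qed auto
  have iYs: "integrable M Ys"
    using Bochner_Integration.integrable_add[OF iX iY] by (simp add: X_def)
  \<comment> \<open>The size bias identity for the identity function says E[Y^2] = \<mu> E[Ys];
    subtract \<mu>^2 on both sides.\<close>
  have EX: "\<mu> * expectation X = \<sigma>\<^sup>2"
  proof -
    have "expectation (\<lambda>\<omega>. Y \<omega> * Y \<omega>) = \<mu> * expectation Ys"
      using sbf[of "\<lambda>x. x"] Y2 iYs by (simp add: power2_eq_square)
    moreover have "\<sigma>\<^sup>2 = expectation (\<lambda>\<omega>. Y \<omega> * Y \<omega>) - \<mu>\<^sup>2"
      unfolding \<sigma>2 using variance_eq[OF iY Y2] by (simp add: \<mu>_def power2_eq_square)
    moreover have "expectation X = expectation Ys - \<mu>"
      using iY iYs by (simp add: X_def[abs_def] \<mu>_def)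
    moreover from this have "\<mu> * expectation X = \<mu> * expectation Ys - \<mu>\<^sup>2"
      by (simp add: right_diff_distrib power2_eq_square)
    ultimately show ?thesis by linarith
  qed
  let ?ov = "\<lambda>\<omega>. overlap (K \<omega> / \<sigma>) (z - W \<omega>) (z + l - W \<omega>)"
  have [measurable]: "?ov \<in> borel_measurable M" unfolding overlap_def by measurable
  \<comment> \<open>The overlap is at most the length \<open>2 * (K \<omega> / \<sigma>)\<close> of
    the window, so a multiple of K^2 dominates.\<close>
  show i_ov: "integrable M (\<lambda>\<omega>. K \<omega> / \<sigma> * ?ov \<omega>)"
  proof (rule Bochner_Integration.integrable_bound[OF integrable_mult_right[OF iK2, of "2 / \<sigma>\<^sup>2"]])
    show "AE \<omega> in M. norm (K \<omega> / \<sigma> * ?ov \<omega>) \<le> norm (2 / \<sigma>\<^sup>2 * (K \<omega>)\<^sup>2)"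
      using XK
    proof eventually_elim
      case (elim \<omega>)
      then have k: "0 \<le> K \<omega> / \<sigma>" using \<sigma> by auto
      have "?ov \<omega> \<le> 2 * (K \<omega> / \<sigma>)" and o: "0 \<le> ?ov \<omega>" using k by (auto simp: overlap_def)
      then have "K \<omega> / \<sigma> * ?ov \<omega> \<le> K \<omega> / \<sigma> * (2 * (K \<omega> / \<sigma>))" by (intro mult_left_mono k)
      moreover have "0 \<le> K \<omega> / \<sigma> * ?ov \<omega>" using k o by (rule mult_nonneg_nonneg)
      moreover have "K \<omega> / \<sigma> * (2 * (K \<omega> / \<sigma>)) = 2 / \<sigma>\<^sup>2 * (K \<omega>)\<^sup>2"
        by (simp add: power2_eq_square)
      ultimately show ?case unfolding real_norm_def by linarith
    qed
  qed auto
  let ?m = "\<integral>x. ramp z l x * std_normal_density x \<partial>lborel"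
  obtain f f' where [measurable]: "f \<in> borel_measurable borel" "f' \<in> borel_measurable borel"
    and f: "\<And>w. \<bar>f w\<bar> \<le> 6" and f': "\<And>w. \<bar>f' w\<bar> \<le> 2"
    and stein: "\<And>w. f' w - w * f w = ramp z l w - ?m"
    and incr: "\<And>w d k. \<bar>d\<bar> \<le> k \<Longrightarrow> \<bar>f (w + d) - f w - d * f' w\<bar>
        \<le> k * (6 * (1 + \<bar>w\<bar>) * k + overlap k (z - w) (z + l - w) / l)"
    by (rule Stein_ramp_solution[OF l, of z]) blast
  define g where "g y = f ((y - \<mu>) / \<sigma>)" for y
  have [measurable]: "g \<in> borel_measurable borel" unfolding g_def by measurable
  have g6: "\<bar>g y\<bar> \<le> 6" for y by (simp add: g_def f)
  have ig: "integrable M (\<lambda>\<omega>. g (Y \<omega>))" "integrable M (\<lambda>\<omega>. g (Ys \<omega>))"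
    by (rule integrable_const_bound[where B=6]; use g6 in auto)+
  have iYg: "integrable M (\<lambda>\<omega>. Y \<omega> * g (Y \<omega>))"
    by (rule Bochner_Integration.integrable_bound[OF integrable_mult_right[OF iY, of 6]])
      (use g6 in \<open>auto simp: abs_mult mult.commute[of _ 6] mult.commute[of "\<bar>Y _\<bar>"] intro!: mult_right_mono\<close>)
  have if': "integrable M (\<lambda>\<omega>. f' (W \<omega>))"
    by (rule integrable_const_bound[where B=2]) (use f' in auto)
  have iXf': "integrable M (\<lambda>\<omega>. f' (W \<omega>) * X \<omega>)"
    by (rule Bochner_Integration.integrable_bound[OF integrable_mult_right[OF iX, of 2]])
      (use f' in \<open>auto simp: abs_mult intro!: mult_right_mono\<close>)
  define R where "R \<omega> = g (Ys \<omega>) - g (Y \<omega>) - X \<omega> / \<sigma> * f' (W \<omega>)" for \<omega>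
  have iR: "integrable M R" unfolding R_def
    using ig iXf' by (auto simp: mult.commute)
  have gW: "g (Y \<omega>) = f (W \<omega>)" for \<omega> by (simp add: g_def W_def)
  have EWf: "expectation (\<lambda>\<omega>. W \<omega> * f (W \<omega>)) = \<mu> / \<sigma> * expectation (\<lambda>\<omega>. g (Ys \<omega>) - g (Y \<omega>))"
  proof -
    have "expectation (\<lambda>\<omega>. W \<omega> * f (W \<omega>)) = expectation (\<lambda>\<omega>. (Y \<omega> * g (Y \<omega>) - \<mu> * g (Y \<omega>)) / \<sigma>)"
      by (intro Bochner_Integration.integral_cong) (auto simp: gW W_def diff_divide_distrib left_diff_distrib)
    also have "\<dots> = (expectation (\<lambda>\<omega>. Y \<omega> * g (Y \<omega>)) - \<mu> * expectation (\<lambda>\<omega>. g (Y \<omega>))) / \<sigma>"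
      using iYg ig by simp
    also have "\<dots> = \<mu> / \<sigma> * expectation (\<lambda>\<omega>. g (Ys \<omega>) - g (Y \<omega>))"
      using sbf[OF _ iYg ig(2)] ig by (simp add: right_diff_distrib diff_divide_distrib)
    finally show ?thesis .
  qed
  have iWf: "integrable M (\<lambda>\<omega>. W \<omega> * f (W \<omega>))"
  proof -
    have "integrable M (\<lambda>\<omega>. (Y \<omega> * g (Y \<omega>) - \<mu> * g (Y \<omega>)) / \<sigma>)" using iYg ig by simp
    then show ?thesis by (simp add: gW W_def diff_divide_distrib left_diff_distrib)
  qed
  have [measurable]: "ramp z l \<in> borel_measurable borel"
    by (rule borel_measurable_continuous_onI[OF continuous_on_ramp[OF l]])
  have ir: "integrable M (\<lambda>\<omega>. ramp z l (W \<omega>))"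
    by (rule integrable_const_bound[where B=1]) (auto simp: ramp_bounds)
  have "expectation (\<lambda>\<omega>. ramp z l (W \<omega>)) - ?m = expectation (\<lambda>\<omega>. ramp z l (W \<omega>) - ?m)"
    using ir by (simp add: prob_space)
  also have "\<dots> = expectation (\<lambda>\<omega>. f' (W \<omega>) - W \<omega> * f (W \<omega>))" by (simp add: stein)
  also have "\<dots> = expectation (\<lambda>\<omega>. f' (W \<omega>)) - \<mu> / \<sigma> * expectation (\<lambda>\<omega>. g (Ys \<omega>) - g (Y \<omega>))"
    using if' iWf by (simp add: EWf)
  also have "expectation (\<lambda>\<omega>. g (Ys \<omega>) - g (Y \<omega>)) = expectation (\<lambda>\<omega>. R \<omega> + f' (W \<omega>) * X \<omega> / \<sigma>)"
    by (simp add: R_def mult.commute)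
  also have "\<dots> = expectation R + expectation (\<lambda>\<omega>. f' (W \<omega>) * X \<omega>) / \<sigma>"
    using iR iXf' by simp
  \<comment> \<open>As \<open>EX\<close> makes \<mu>/\<sigma>^2 times E[X] equal to 1, the term E
    f'(W) can be written as \<mu>/\<sigma>^2 times E[X] E[f'(W)], and a covariance appears.\<close>
  also have "expectation (\<lambda>\<omega>. f' (W \<omega>)) - \<mu> / \<sigma> * (expectation R + expectation (\<lambda>\<omega>. f' (W \<omega>) * X \<omega>) / \<sigma>)
      = - (\<mu> / \<sigma>\<^sup>2) * (expectation (\<lambda>\<omega>. f' (W \<omega>) * X \<omega>) - expectation X * expectation (\<lambda>\<omega>. f' (W \<omega>)))
        - \<mu> / \<sigma> * expectation R" (is "?lhs = _")
  proof -
    have "\<mu> / \<sigma>\<^sup>2 * expectation X = 1" using EX \<sigma> by (simp add: field_simps)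
    then have "\<mu> / \<sigma>\<^sup>2 * (expectation X * expectation (\<lambda>\<omega>. f' (W \<omega>))) = expectation (\<lambda>\<omega>. f' (W \<omega>))"
      by (simp only: mult.assoc[symmetric] mult_1)
    then show ?thesis by (simp add: algebra_simps power2_eq_square)
  qed
  also have "expectation (\<lambda>\<omega>. f' (W \<omega>) * X \<omega>) - expectation X * expectation (\<lambda>\<omega>. f' (W \<omega>))
      = expectation (\<lambda>\<omega>. f' (W \<omega>) * (X \<omega> - expectation X))"
    using iXf' if' by (simp add: right_diff_distrib)
  finally have main: "expectation (\<lambda>\<omega>. ramp z l (W \<omega>)) - ?m
      = - (\<mu> / \<sigma>\<^sup>2) * expectation (\<lambda>\<omega>. f' (W \<omega>) * (X \<omega> - expectation X)) - \<mu> / \<sigma> * expectation R" .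
  have "\<bar>expectation (\<lambda>\<omega>. f' (W \<omega>) * (X \<omega> - expectation X))\<bar> \<le> 2 * sqrt (variance (cond_exp_given M Y X))"
    using integral_mult_centered_le[of X Y "\<lambda>y. f' ((y - \<mu>) / \<sigma>)" 2] f' iX2 by (simp add: W_def)
  then have t1: "\<bar>\<mu> / \<sigma>\<^sup>2 * expectation (\<lambda>\<omega>. f' (W \<omega>) * (X \<omega> - expectation X))\<bar>
      \<le> \<mu> / \<sigma>\<^sup>2 * (2 * sqrt (variance (cond_exp_given M Y X)))"
    unfolding abs_mult by (intro mult_mono) (use \<mu> \<sigma> in auto)
  let ?bd = "\<lambda>\<omega>. 6 / \<sigma>\<^sup>2 * ((1 + \<bar>W \<omega>\<bar>) * (K \<omega>)\<^sup>2) + 1 / l * (K \<omega> / \<sigma> * ?ov \<omega>)"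
  have "\<bar>expectation R\<bar> \<le> expectation (\<lambda>\<omega>. \<bar>R \<omega>\<bar>)" by (rule integral_abs_bound)
  also have "\<dots> \<le> expectation ?bd"
  proof (rule integral_mono_AE)
    show "AE \<omega> in M. \<bar>R \<omega>\<bar> \<le> ?bd \<omega>"
      using XK
    proof eventually_elim
      case (elim \<omega>)
      have "\<bar>X \<omega> / \<sigma>\<bar> \<le> K \<omega> / \<sigma>" using elim \<sigma> by (simp add: divide_right_mono)
      from incr[OF this, of "W \<omega>"]
      have "\<bar>f (W \<omega> + X \<omega> / \<sigma>) - f (W \<omega>) - X \<omega> / \<sigma> * f' (W \<omega>)\<bar>
          \<le> K \<omega> / \<sigma> * (6 * (1 + \<bar>W \<omega>\<bar>) * (K \<omega> / \<sigma>) + ?ov \<omega> / l)" .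
      moreover have "W \<omega> + X \<omega> / \<sigma> = (Ys \<omega> - \<mu>) / \<sigma>"
        by (simp add: W_def X_def diff_divide_distrib)
      moreover have "k / \<sigma> * (6 * c * (k / \<sigma>) + v / l) = 6 / \<sigma>\<^sup>2 * (c * k\<^sup>2) + 1 / l * (k / \<sigma> * v)" for k c v
        by (simp add: distrib_left power2_eq_square mult_ac)
      ultimately show ?case by (simp only: R_def gW) (simp only: g_def)
    qed
  qed (intro integrable_abs iR Bochner_Integration.integrable_add integrable_mult_right K2 i_ov)+
  also have "\<dots> = 6 / \<sigma>\<^sup>2 * (\<integral>\<omega>. (1 + \<bar>W \<omega>\<bar>) * (K \<omega>)\<^sup>2 \<partial>M) + 1 / l * (\<integral>\<omega>. K \<omega> / \<sigma> * ?ov \<omega> \<partial>M)"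
    by (subst Bochner_Integration.integral_add[OF integrable_mult_right[OF K2] integrable_mult_right[OF i_ov]])
      (simp only: integral_mult_right_zero)
  finally have "\<bar>\<mu> / \<sigma> * expectation R\<bar> \<le> \<mu> / \<sigma> * \<dots>"
    unfolding abs_mult by (intro mult_mono) (use \<mu> \<sigma> in auto)
  then have t2: "\<bar>\<mu> / \<sigma> * expectation R\<bar> \<le> 6 * \<mu> / \<sigma>^3 * (\<integral>\<omega>. (1 + \<bar>W \<omega>\<bar>) * (K \<omega>)\<^sup>2 \<partial>M)
        + \<mu> / (\<sigma> * l) * (\<integral>\<omega>. K \<omega> / \<sigma> * ?ov \<omega> \<partial>M)"
    by (simp add: distrib_left power2_eq_square power3_eq_cube mult_ac)
  have "\<bar>expectation (\<lambda>\<omega>. ramp z l (W \<omega>)) - ?m\<bar> \<le>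
      \<mu> / \<sigma>\<^sup>2 * (2 * sqrt (variance (cond_exp_given M Y X)))
      + (6 * \<mu> / \<sigma>^3 * (\<integral>\<omega>. (1 + \<bar>W \<omega>\<bar>) * (K \<omega>)\<^sup>2 \<partial>M)
        + \<mu> / (\<sigma> * l) * (\<integral>\<omega>. K \<omega> / \<sigma> * ?ov \<omega> \<partial>M))"
    unfolding main using t1 t2 by linarith
  then show "\<bar>expectation (\<lambda>\<omega>. ramp z l (W \<omega>)) - ?m\<bar>
      \<le> 2 * \<mu> / \<sigma>\<^sup>2 * sqrt (variance (cond_exp_given M Y (\<lambda>\<omega>. Ys \<omega> - Y \<omega>)))
        + 6 * \<mu> / \<sigma>^3 * (\<integral>\<omega>. (1 + \<bar>W \<omega>\<bar>) * (K \<omega>)\<^sup>2 \<partial>M)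
        + \<mu> / (\<sigma> * l) * (\<integral>\<omega>. K \<omega> / \<sigma> * ?ov \<omega> \<partial>M)"
    unfolding X_def[abs_def] by (simp add: mult.commute)
qed

subsection \<open>Concentration\<close>

text \<open>The level sets of \<open>c\<close> split the space into countably many measurable
  pieces. On each piece a random interval coded by \<open>c\<close> becomes a fixed one.\<close>

lemma nn_integral_le_of_fibres:
  fixes c :: "'a \<Rightarrow> nat"
  assumes [measurable]: "c \<in> measurable M (count_space UNIV)" "g \<in> borel_measurable M" "g' \<in> borel_measurable M"
    and le: "\<And>n. (\<integral>\<^sup>+\<omega>. g \<omega> * indicator {\<omega>\<in>space M. c \<omega> = n} \<omega> \<partial>M) \<le> (\<integral>\<^sup>+\<omega>. g' \<omega> * indicator {\<omega>\<in>space M. c \<omega> = n} \<omega> \<partial>M)"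
  shows "(\<integral>\<^sup>+\<omega>. g \<omega> \<partial>M) \<le> (\<integral>\<^sup>+\<omega>. g' \<omega> \<partial>M)"
proof -
  let ?A = "\<lambda>n. {\<omega>\<in>space M. c \<omega> = n}"
  have U: "(\<Union>n. ?A n) = space M" by auto
  have d: "disjoint_family ?A" by (auto simp: disjoint_family_on_def)
  have eq: "(\<integral>\<^sup>+\<omega>. f \<omega> \<partial>M) = (\<Sum>n. \<integral>\<^sup>+\<omega>. f \<omega> * indicator (?A n) \<omega> \<partial>M)"
    if [measurable]: "f \<in> borel_measurable M" for f
  proof -
    have "(\<integral>\<^sup>+\<omega>. f \<omega> \<partial>M) = (\<integral>\<^sup>+\<omega>\<in>(\<Union>n. ?A n). f \<omega> \<partial>M)"
      unfolding U by (intro nn_integral_cong) auto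
    also have "\<dots> = (\<Sum>n. \<integral>\<^sup>+\<omega>. f \<omega> * indicator (?A n) \<omega> \<partial>M)"
      by (rule nn_integral_disjoint_family[OF _ _ d]) auto
    finally show ?thesis .
  qed
  show ?thesis unfolding eq[OF assms(2)] eq[OF assms(3)] by (intro suminf_le le) auto
qed

text \<open>The weight \<open>H \<omega> * indicator A \<omega>\<close> is measurable for the
  subalgebra, so the indicator of \<open>S\<close> may be replaced by its conditional expectation.
  Nonnegative integrals allow a weight \<open>H\<close> without any integrability; the bound on
  \<open>real_cond_exp\<close> is first transferred to \<open>nn_cond_exp\<close>.\<close>

lemma (in sigma_finite_subalgebra) nn_integral_indicator_cond_le:
  fixes V :: "'a \<Rightarrow> real" and p :: real
  assumes [measurable]: "V \<in> borel_measurable M" "S \<in> sets borel" "H \<in> borel_measurable F" "A \<in> sets F"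
    and le: "AE \<omega> in M. \<omega> \<in> A \<longrightarrow> real_cond_exp M F (\<lambda>\<omega>. indicator S (V \<omega>)) \<omega> \<le> p"
  shows "(\<integral>\<^sup>+\<omega>. H \<omega> * indicator A \<omega> * indicator S (V \<omega>) \<partial>M) \<le> (\<integral>\<^sup>+\<omega>. H \<omega> * indicator A \<omega> * ennreal p \<partial>M)"
proof -
  let ?g = "\<lambda>\<omega>. ennreal (indicator S (V \<omega>))"
  have "AE \<omega> in M. nn_cond_exp M F ?g \<omega> \<le> nn_cond_exp M F (\<lambda>_. 1) \<omega>"
    by (rule nn_cond_exp_mono) (auto simp: indicator_def)
  moreover have "AE \<omega> in M. 1 = nn_cond_exp M F (\<lambda>_. 1) \<omega>"
    by (rule nn_cond_exp_F_meas) auto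
  moreover have "AE \<omega> in M. 0 = nn_cond_exp M F (\<lambda>_. 0) \<omega>"
    by (rule nn_cond_exp_F_meas) auto
  ultimately have *: "AE \<omega> in M. \<omega> \<in> A \<longrightarrow> nn_cond_exp M F ?g \<omega> \<le> ennreal p"
    using le
  proof eventually_elim
    case (elim \<omega>)
    \<comment> \<open>\<open>real_cond_exp\<close> subtracts the conditional expectation of the
      negative part, which is zero here. Finiteness of the positive part is needed as well, since
      \<open>enn2real\<close> sends infinity to 0.\<close>
    have z: "(\<lambda>x. ennreal (- indicator S (V x))) = (\<lambda>_. 0)" by (auto simp: indicator_def ennreal_neg)
    have fin: "nn_cond_exp M F ?g \<omega> < top"
      using elim(1,2) by (metis ennreal_one_less_top le_less_trans)
    show ?case
    proof
      assume "\<omega> \<in> A"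
      then have "enn2real (nn_cond_exp M F ?g \<omega>) \<le> p"
        using elim(3,4) by (simp add: real_cond_exp_def z)
      then show "nn_cond_exp M F ?g \<omega> \<le> ennreal p"
        using fin by (metis ennreal_enn2real ennreal_leI)
    qed
  qed
  have [measurable]: "(\<lambda>\<omega>. H \<omega> * indicator A \<omega>) \<in> borel_measurable F" by measurable
  have "(\<integral>\<^sup>+\<omega>. H \<omega> * indicator A \<omega> * indicator S (V \<omega>) \<partial>M) = (\<integral>\<^sup>+\<omega>. H \<omega> * indicator A \<omega> * ?g \<omega> \<partial>M)"
    by (simp add: ennreal_indicator)
  also have "\<dots> = (\<integral>\<^sup>+\<omega>. H \<omega> * indicator A \<omega> * nn_cond_exp M F ?g \<omega> \<partial>M)"
    by (rule nn_cond_exp_intg[symmetric]) auto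
  also have "\<dots> \<le> (\<integral>\<^sup>+\<omega>. H \<omega> * indicator A \<omega> * ennreal p \<partial>M)"
    by (rule nn_integral_mono_AE) (use * in \<open>eventually_elim, auto simp: indicator_def intro!: mult_left_mono\<close>)
  finally show ?thesis .
qed

lemma borel_measurable_indicator_Icc [measurable (raw)]:
  fixes a b v :: "'a \<Rightarrow> real"
  assumes [measurable]: "a \<in> borel_measurable N" "b \<in> borel_measurable N" "v \<in> borel_measurable N"
  shows "(\<lambda>x. indicator {a x..b x} (v x) :: ennreal) \<in> borel_measurable N"
proof -
  have "(\<lambda>x. indicator {a x..b x} (v x) :: ennreal) = (\<lambda>x. if a x \<le> v x \<and> v x \<le> b x then 1 else 0)"
    by (auto simp: indicator_def)
  also have "\<dots> \<in> borel_measurable N" by measurable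
  finally show ?thesis .
qed

text \<open>The conditional bound is only available almost surely for each fixed interval; rounding the
  end points of the random interval outward to the grid \<open>e \<int>\<close> leaves countably many intervals.\<close>

lemma (in sigma_finite_subalgebra) nn_integral_random_interval_le:
  fixes V a b :: "'a \<Rightarrow> real" and \<kappa> \<eta> e :: real
  assumes V[measurable]: "V \<in> borel_measurable M" and H: "H \<in> borel_measurable F" and A: "A \<in> sets F"
    and a: "a \<in> borel_measurable F" and b: "b \<in> borel_measurable F"
    and ab: "\<And>\<omega>. a \<omega> \<le> b \<omega>" and e: "0 < e" and \<kappa>: "0 \<le> \<kappa>"
    and le: "\<And>p q. p \<le> q \<Longrightarrow> AE \<omega> in M. \<omega> \<in> A \<longrightarrow>
        real_cond_exp M F (\<lambda>\<omega>. indicator {p<..q} (V \<omega>)) \<omega> \<le> \<kappa> * (q - p) + \<eta>"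
  shows "(\<integral>\<^sup>+\<omega>. H \<omega> * indicator A \<omega> * indicator {a \<omega>..b \<omega>} (V \<omega>) \<partial>M)
    \<le> (\<integral>\<^sup>+\<omega>. H \<omega> * indicator A \<omega> * ennreal (\<kappa> * (b \<omega> - a \<omega> + 2 * e) + \<eta>) \<partial>M)"
proof -
  have [measurable]: "H \<in> borel_measurable M" "a \<in> borel_measurable M" "b \<in> borel_measurable M" "A \<in> sets M"
    using H a b A subalg by (auto intro: measurable_from_subalg simp: subalgebra_def)
  have sp: "space F = space M" using subalg by (simp add: subalgebra_def)
  \<comment> \<open>Encodes the rounded end points (i, j). The left index is lowered by 1 because
    the intervals in \<open>le\<close> are open on the left: then [a, b] lies in (i e, j e], and
    each end point has moved by at most e, whence the \<open>2 * e\<close>.\<close>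
  define c where "c \<omega> = to_nat (\<lceil>a \<omega> / e\<rceil> - 1, \<lceil>b \<omega> / e\<rceil>)" for \<omega>
  have c_F: "c \<in> measurable F (count_space UNIV)"
  proof -
    note [measurable] = a b
    show ?thesis unfolding c_def by measurable
  qed
  have c_M[measurable]: "c \<in> measurable M (count_space UNIV)" by (rule measurable_from_subalg[OF subalg c_F])
  show ?thesis
  proof (rule nn_integral_le_of_fibres[of c])
    show "(\<lambda>\<omega>. H \<omega> * indicator A \<omega> * indicator {a \<omega>..b \<omega>} (V \<omega>)) \<in> borel_measurable M"
      by measurable
  next
    fix n
    obtain i j :: int where ij: "from_nat n = (i, j)" by fastforce
    have cn: "real_of_int i * e < a \<omega> \<and> a \<omega> \<le> (i + 1) * e \<and> b \<omega> \<le> j * e \<and> j * e < b \<omega> + e" if "c \<omega> = n" for \<omega>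
    proof -
      have "(\<lceil>a \<omega> / e\<rceil> - 1, \<lceil>b \<omega> / e\<rceil>) = (i, j)"
        using that ij unfolding c_def by (metis from_nat_to_nat)
      then have "\<lceil>a \<omega> / e\<rceil> = i + 1" "\<lceil>b \<omega> / e\<rceil> = j" by auto
      then have "i < a \<omega> / e" "a \<omega> / e \<le> i + 1" "b \<omega> / e \<le> j" "j < b \<omega> / e + 1"
        by linarith+
      then show ?thesis using e by (simp add: field_simps)
    qed
    let ?I = "\<lambda>\<omega>. indicator {\<omega> \<in> space M. c \<omega> = n} \<omega> :: ennreal"
    show "(\<integral>\<^sup>+\<omega>. H \<omega> * indicator A \<omega> * indicator {a \<omega>..b \<omega>} (V \<omega>) * ?I \<omega> \<partial>M)
      \<le> (\<integral>\<^sup>+\<omega>. H \<omega> * indicator A \<omega> * ennreal (\<kappa> * (b \<omega> - a \<omega> + 2 * e) + \<eta>) * ?I \<omega> \<partial>M)"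
    proof (cases "i * e \<le> j * e")
      case False
      \<comment> \<open>On a nonempty fibre i e < a, a is at most b, and b is at most j e; so the
        fibre of \<open>n\<close> is empty in this case.\<close>
      have "?I \<omega> = 0" for \<omega>
        using cn[of \<omega>] ab[of \<omega>] False by (auto simp: indicator_def)
      then show ?thesis by simp
    next
      case True
      have HI: "(\<lambda>\<omega>. H \<omega> * ?I \<omega>) \<in> borel_measurable F"
      proof -
        note [measurable] = H c_F
        show ?thesis unfolding sp[symmetric] by measurable
      qed
      have "(\<integral>\<^sup>+\<omega>. H \<omega> * indicator A \<omega> * indicator {a \<omega>..b \<omega>} (V \<omega>) * ?I \<omega> \<partial>M)
        \<le> (\<integral>\<^sup>+\<omega>. (H \<omega> * ?I \<omega>) * indicator A \<omega> * indicator {i*e<..j*e} (V \<omega>) \<partial>M)"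
      proof (intro nn_integral_mono)
        fix \<omega> show "H \<omega> * indicator A \<omega> * indicator {a \<omega>..b \<omega>} (V \<omega>) * ?I \<omega>
            \<le> (H \<omega> * ?I \<omega>) * indicator A \<omega> * indicator {i*e<..j*e} (V \<omega>)"
          using cn[of \<omega>] by (auto simp: indicator_def)
      qed
      also have "\<dots> \<le> (\<integral>\<^sup>+\<omega>. (H \<omega> * ?I \<omega>) * indicator A \<omega> * ennreal (\<kappa> * (j * e - i * e) + \<eta>) \<partial>M)"
        by (rule nn_integral_indicator_cond_le[OF V _ HI A le[OF True]]) auto
      also have "\<dots> \<le> (\<integral>\<^sup>+\<omega>. H \<omega> * indicator A \<omega> * ennreal (\<kappa> * (b \<omega> - a \<omega> + 2 * e) + \<eta>) * ?I \<omega> \<partial>M)"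
      proof (intro nn_integral_mono)
        fix \<omega>
        have "\<kappa> * (j * e - i * e) + \<eta> \<le> \<kappa> * (b \<omega> - a \<omega> + 2 * e) + \<eta>" if "c \<omega> = n"
          using cn[OF that] \<kappa> by (intro add_right_mono mult_left_mono) (auto simp: algebra_simps)
        then show "(H \<omega> * ?I \<omega>) * indicator A \<omega> * ennreal (\<kappa> * (j * e - i * e) + \<eta>)
          \<le> H \<omega> * indicator A \<omega> * ennreal (\<kappa> * (b \<omega> - a \<omega> + 2 * e) + \<eta>) * ?I \<omega>"
          by (auto simp: indicator_def intro!: mult_left_mono ennreal_leI)
      qed
      finally show ?thesis .
    qed
  qed measurable
qed

lemma emeasure_overlap: "emeasure lborel ({- k..k} \<inter> {a..b}) = ennreal (overlap k a b)"
proof -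
  have eq: "{- k..k} \<inter> {a..b} = {max (- k) a..min k b}" by auto
  show ?thesis
  proof (cases "max (- k) a \<le> min k b")
    case True
    moreover from this have "overlap k a b = min k b - max (- k) a" unfolding overlap_def by linarith
    ultimately show ?thesis unfolding eq by (simp only: emeasure_lborel_Icc)
  next
    case False
    then have "{max (- k) a..min k b} = {}" by (simp only: atLeastatMost_empty_iff simp_thms)
    moreover have "overlap k a b = 0" using False unfolding overlap_def by linarith
    ultimately show ?thesis unfolding eq by simp
  qed
qed

text \<open>The overlap is the integral over u in [-k, k] of the indicator that W + u lies in
  [z, z + l]. After exchanging the integrals, u is fixed. Outside \<open>A\<close> the indicator is
  bounded by 1; on \<open>A\<close> the event forces V into an interval with
  \<open>G\<close>-measurable end points and length l + 2 b, to which the conditional bound applies.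
  Integrating k over u turns it into 2 k^2.\<close>

lemma (in prob_space) nn_integral_overlap_le:
  fixes W V k b :: "'a \<Rightarrow> real" and \<kappa> \<eta> l z :: real
  assumes sub: "subalgebra M G"
    and W[measurable]: "W \<in> borel_measurable M" and V[measurable]: "V \<in> borel_measurable M"
    and k: "k \<in> borel_measurable G" and b: "b \<in> borel_measurable G" and A: "A \<in> sets G"
    and k0: "\<And>\<omega>. 0 \<le> k \<omega>" and b0: "\<And>\<omega>. 0 \<le> b \<omega>" and l: "0 < l" and \<kappa>: "0 \<le> \<kappa>"
    and WV: "AE \<omega> in M. \<bar>W \<omega> - V \<omega>\<bar> \<le> b \<omega>"
    and le: "\<And>p q. p \<le> q \<Longrightarrow> AE \<omega> in M. \<omega> \<in> A \<longrightarrow>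
        real_cond_exp M G (\<lambda>\<omega>. indicator {p<..q} (V \<omega>)) \<omega> \<le> \<kappa> * (q - p) + \<eta>"
  shows "(\<integral>\<^sup>+\<omega>. ennreal (k \<omega> * overlap (k \<omega>) (z - W \<omega>) (z + l - W \<omega>)) \<partial>M)
    \<le> (\<integral>\<^sup>+\<omega>. ennreal (2 * (k \<omega>)\<^sup>2 * (1 - indicator A \<omega>)) \<partial>M)
      + (\<integral>\<^sup>+\<omega>. ennreal (2 * (k \<omega>)\<^sup>2) * indicator A \<omega> * ennreal (\<kappa> * (3 * l + 2 * b \<omega>) + \<eta>) \<partial>M)"
proof -
  interpret finite_measure_subalgebra M G by unfold_locales (rule sub)
  interpret P: pair_sigma_finite M lborel ..
  have [measurable]: "k \<in> borel_measurable M" "b \<in> borel_measurable M" "A \<in> sets M"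
    using k b A sub by (auto intro: measurable_from_subalg simp: subalgebra_def)
  let ?k = "\<lambda>\<omega> u. ennreal (k \<omega>) * indicator {- k \<omega>..k \<omega>} u"
  let ?Q = "\<lambda>\<omega>. ennreal (\<kappa> * (3 * l + 2 * b \<omega>) + \<eta>)"
  have m1[measurable]: "(\<lambda>(\<omega>, u). ?k \<omega> u * indicator {z - W \<omega>..z + l - W \<omega>} u) \<in> borel_measurable (M \<Otimes>\<^sub>M lborel)"
    by measurable
  have m2[measurable]: "(\<lambda>(\<omega>, u). ?k \<omega> u * (indicator (space M - A) \<omega> + indicator A \<omega> * ?Q \<omega>)) \<in> borel_measurable (M \<Otimes>\<^sub>M lborel)"
    by measurable
  have kk: "(\<integral>\<^sup>+u. ?k \<omega> u * c \<partial>lborel) = ennreal (2 * (k \<omega>)\<^sup>2) * c" for \<omega> c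
  proof -
    have "(\<integral>\<^sup>+u. ?k \<omega> u * c \<partial>lborel) = ennreal (k \<omega>) * c * emeasure lborel {- k \<omega>..k \<omega>}"
      by (subst nn_integral_cmult_indicator[symmetric]) (auto intro!: nn_integral_cong simp: mult_ac)
    also have "emeasure lborel {- k \<omega>..k \<omega>} = ennreal (2 * k \<omega>)" using k0[of \<omega>] by simp
    also have "ennreal (k \<omega>) * c * ennreal (2 * k \<omega>) = (ennreal (k \<omega>) * ennreal (2 * k \<omega>)) * c" by (simp add: mult_ac)
    also have "ennreal (k \<omega>) * ennreal (2 * k \<omega>) = ennreal (2 * (k \<omega>)\<^sup>2)"
      using k0[of \<omega>] by (simp add: power2_eq_square mult_ac flip: ennreal_mult)
    finally show ?thesis .
  qed
  have fibre: "(\<integral>\<^sup>+\<omega>. ?k \<omega> u * indicator {z - W \<omega>..z + l - W \<omega>} u \<partial>M)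
      \<le> (\<integral>\<^sup>+\<omega>. ?k \<omega> u * (indicator (space M - A) \<omega> + indicator A \<omega> * ?Q \<omega>) \<partial>M)" for u
  proof -
    have ku_G: "(\<lambda>\<omega>. ?k \<omega> u) \<in> borel_measurable G"
      and ab_G: "(\<lambda>\<omega>. z - u - b \<omega>) \<in> borel_measurable G" "(\<lambda>\<omega>. z + l - u + b \<omega>) \<in> borel_measurable G"
    proof -
      note [measurable] = k b
      show "(\<lambda>\<omega>. ?k \<omega> u) \<in> borel_measurable G"
        "(\<lambda>\<omega>. z - u - b \<omega>) \<in> borel_measurable G" "(\<lambda>\<omega>. z + l - u + b \<omega>) \<in> borel_measurable G"
        by measurable
    qed
    have ku_M[measurable]: "(\<lambda>\<omega>. ?k \<omega> u) \<in> borel_measurable M" by (rule measurable_from_subalg[OF sub ku_G])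
    let ?a = "\<lambda>\<omega>. z - u - b \<omega>" and ?b = "\<lambda>\<omega>. z + l - u + b \<omega>"
    have "(\<integral>\<^sup>+\<omega>. ?k \<omega> u * indicator {z - W \<omega>..z + l - W \<omega>} u \<partial>M)
      \<le> (\<integral>\<^sup>+\<omega>. ?k \<omega> u * indicator (space M - A) \<omega> + ?k \<omega> u * indicator A \<omega> * indicator {?a \<omega>..?b \<omega>} (V \<omega>) \<partial>M)"
    proof (rule nn_integral_mono_AE)
      show "AE \<omega> in M. ?k \<omega> u * indicator {z - W \<omega>..z + l - W \<omega>} u
        \<le> ?k \<omega> u * indicator (space M - A) \<omega> + ?k \<omega> u * indicator A \<omega> * indicator {?a \<omega>..?b \<omega>} (V \<omega>)"
        using WV AE_space by eventually_elim (auto simp: indicator_def)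
    qed
    also have "\<dots> = (\<integral>\<^sup>+\<omega>. ?k \<omega> u * indicator (space M - A) \<omega> \<partial>M)
        + (\<integral>\<^sup>+\<omega>. ?k \<omega> u * indicator A \<omega> * indicator {?a \<omega>..?b \<omega>} (V \<omega>) \<partial>M)"
      by (rule nn_integral_add) measurable
    also have "(\<integral>\<^sup>+\<omega>. ?k \<omega> u * indicator A \<omega> * indicator {?a \<omega>..?b \<omega>} (V \<omega>) \<partial>M)
        \<le> (\<integral>\<^sup>+\<omega>. ?k \<omega> u * indicator A \<omega> * ennreal (\<kappa> * (?b \<omega> - ?a \<omega> + 2 * l) + \<eta>) \<partial>M)"
    \<comment> \<open>The grid width is taken equal to \<open>l\<close>, which makes the total
      length 3 l + 2 b.\<close>
    proof (rule nn_integral_random_interval_le[OF V ku_G A ab_G _ l \<kappa> le])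
      show "?a \<omega> \<le> ?b \<omega>" for \<omega> using b0[of \<omega>] l by simp
    qed auto
    also have "\<dots> = (\<integral>\<^sup>+\<omega>. ?k \<omega> u * indicator A \<omega> * ?Q \<omega> \<partial>M)"
      by (intro nn_integral_cong arg_cong2[where f="(*)"] refl arg_cong[where f=ennreal]) (simp add: algebra_simps)
    also have "(\<integral>\<^sup>+\<omega>. ?k \<omega> u * indicator (space M - A) \<omega> \<partial>M) + \<dots>
        = (\<integral>\<^sup>+\<omega>. ?k \<omega> u * indicator (space M - A) \<omega> + ?k \<omega> u * indicator A \<omega> * ?Q \<omega> \<partial>M)"
      by (rule nn_integral_add[symmetric]) measurable
    also have "\<dots> = (\<integral>\<^sup>+\<omega>. ?k \<omega> u * (indicator (space M - A) \<omega> + indicator A \<omega> * ?Q \<omega>) \<partial>M)"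
      by (simp add: distrib_left mult.assoc)
    finally show ?thesis by (simp add: add_left_mono)
  qed
  have "(\<integral>\<^sup>+\<omega>. ennreal (k \<omega> * overlap (k \<omega>) (z - W \<omega>) (z + l - W \<omega>)) \<partial>M)
      = (\<integral>\<^sup>+\<omega>. \<integral>\<^sup>+u. ?k \<omega> u * indicator {z - W \<omega>..z + l - W \<omega>} u \<partial>lborel \<partial>M)"
  proof (rule nn_integral_cong)
    fix \<omega>
    have "ennreal (k \<omega> * overlap (k \<omega>) (z - W \<omega>) (z + l - W \<omega>))
        = ennreal (k \<omega>) * emeasure lborel ({- k \<omega>..k \<omega>} \<inter> {z - W \<omega>..z + l - W \<omega>})"
      unfolding emeasure_overlap using k0[of \<omega>] by (simp add: ennreal_mult overlap_def)
    also have "\<dots> = (\<integral>\<^sup>+u. ?k \<omega> u * indicator {z - W \<omega>..z + l - W \<omega>} u \<partial>lborel)"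
      by (subst nn_integral_cmult_indicator[symmetric]) (auto intro!: nn_integral_cong simp: indicator_def)
    finally show "ennreal (k \<omega> * overlap (k \<omega>) (z - W \<omega>) (z + l - W \<omega>)) = \<dots>" .
  qed
  also have "\<dots> = (\<integral>\<^sup>+u. \<integral>\<^sup>+\<omega>. ?k \<omega> u * indicator {z - W \<omega>..z + l - W \<omega>} u \<partial>M \<partial>lborel)"
    by (rule P.Fubini'[symmetric]) (rule m1)
  also have "\<dots> \<le> (\<integral>\<^sup>+u. \<integral>\<^sup>+\<omega>. ?k \<omega> u * (indicator (space M - A) \<omega> + indicator A \<omega> * ?Q \<omega>) \<partial>M \<partial>lborel)"
    by (intro nn_integral_mono fibre)
  also have "\<dots> = (\<integral>\<^sup>+\<omega>. \<integral>\<^sup>+u. ?k \<omega> u * (indicator (space M - A) \<omega> + indicator A \<omega> * ?Q \<omega>) \<partial>lborel \<partial>M)"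
    by (rule P.Fubini') (rule m2)
  also have "\<dots> = (\<integral>\<^sup>+\<omega>. ennreal (2 * (k \<omega>)\<^sup>2) * indicator (space M - A) \<omega> + ennreal (2 * (k \<omega>)\<^sup>2) * indicator A \<omega> * ?Q \<omega> \<partial>M)"
    unfolding kk by (simp add: distrib_left mult.assoc)
  also have "\<dots> = (\<integral>\<^sup>+\<omega>. ennreal (2 * (k \<omega>)\<^sup>2) * indicator (space M - A) \<omega> \<partial>M)
      + (\<integral>\<^sup>+\<omega>. ennreal (2 * (k \<omega>)\<^sup>2) * indicator A \<omega> * ?Q \<omega> \<partial>M)"
    by (rule nn_integral_add) measurable
  also have "(\<integral>\<^sup>+\<omega>. ennreal (2 * (k \<omega>)\<^sup>2) * indicator (space M - A) \<omega> \<partial>M)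
      = (\<integral>\<^sup>+\<omega>. ennreal (2 * (k \<omega>)\<^sup>2 * (1 - indicator A \<omega>)) \<partial>M)"
    by (intro nn_integral_cong) (auto simp: indicator_def)
  finally show ?thesis .
qed

subsection \<open>The Berry--Esseen bound\<close>

lemma std_normal_integral_ramp_bounds:
  assumes l: "0 < l"
  shows "Phi z \<le> (\<integral>x. ramp z l x * std_normal_density x \<partial>lborel)"
    and "(\<integral>x. ramp z l x * std_normal_density x \<partial>lborel) \<le> Phi (z + l)"
proof -
  have ind: "integrable lborel (\<lambda>x. indicator {..w} x * std_normal_density x)" for w
    using integrable_mult_indicator[OF _ integrable_std_normal_density, of "{..w}"] by simp
  have [measurable]: "ramp z l \<in> borel_measurable borel"
    by (rule borel_measurable_continuous_onI[OF continuous_on_ramp[OF l]])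
  have ir: "integrable lborel (\<lambda>x. ramp z l x * std_normal_density x)"
    by (rule Bochner_Integration.integrable_bound[OF integrable_std_normal_density])
       (auto simp: abs_mult ramp_bounds intro!: mult_left_le_one_le)
  show "Phi z \<le> (\<integral>x. ramp z l x * std_normal_density x \<partial>lborel)"
    unfolding Phi_eq using l
    by (intro integral_mono ind ir mult_right_mono) (auto simp: indicator_def ramp_eq_1 ramp_bounds)
  show "(\<integral>x. ramp z l x * std_normal_density x \<partial>lborel) \<le> Phi (z + l)"
    unfolding Phi_eq using l
    by (intro integral_mono ind ir mult_right_mono) (auto simp: indicator_def ramp_eq_0 ramp_bounds)
qed

text \<open>The indicator of {..z} lies between the ramps starting at z - l and at z. The
  corresponding normal integrals differ from \<open>Phi z\<close> by at most l because
  \<open>Phi\<close> is 1-Lipschitz.\<close>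

lemma (in prob_space) Kolmogorov_distance_le_ramp:
  assumes [measurable]: "W \<in> borel_measurable M" and l: "0 < l"
    and e: "\<And>z. \<bar>(\<integral>\<omega>. ramp z l (W \<omega>) \<partial>M) - (\<integral>x. ramp z l x * std_normal_density x \<partial>lborel)\<bar> \<le> e"
  shows "\<bar>prob {\<omega> \<in> space M. W \<omega> \<le> z} - Phi z\<bar> \<le> e + l"
proof -
  have [measurable]: "ramp z l \<in> borel_measurable borel" for z
    by (rule borel_measurable_continuous_onI[OF continuous_on_ramp[OF l]])
  have ir: "integrable M (\<lambda>\<omega>. ramp z l (W \<omega>))" for z
    by (rule integrable_const_bound[where B=1]) (auto simp: ramp_bounds)
  have P: "prob {\<omega> \<in> space M. W \<omega> \<le> z} = (\<integral>\<omega>. indicator {\<omega> \<in> space M. W \<omega> \<le> z} \<omega> \<partial>M)" for z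
    by (simp add: Int_absorb2)
  have i: "integrable M (\<lambda>\<omega>. indicator {\<omega> \<in> space M. W \<omega> \<le> z} \<omega> :: real)" for z
    by (rule integrable_const_bound[where B=1]) (auto simp: indicator_def)
  have "prob {\<omega> \<in> space M. W \<omega> \<le> z} \<le> (\<integral>\<omega>. ramp z l (W \<omega>) \<partial>M)"
    unfolding P using l by (intro integral_mono i ir) (auto simp: indicator_def ramp_eq_1 ramp_bounds)
  moreover have "(\<integral>\<omega>. ramp (z - l) l (W \<omega>) \<partial>M) \<le> prob {\<omega> \<in> space M. W \<omega> \<le> z}"
    unfolding P using l by (intro integral_mono i ir) (auto simp: indicator_def ramp_eq_0 ramp_bounds)
  ultimately show ?thesis
    using e[of z] e[of "z - l"] std_normal_integral_ramp_bounds[OF l, of z]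
      std_normal_integral_ramp_bounds[OF l, of "z - l"] Phi_diff_le[of z "z + l"] Phi_diff_le[of "z - l" z] l
    unfolding abs_le_iff diff_add_cancel by linarith
qed

text \<open>Bounds on nonnegative integrals carry integrability with them; this passes to Bochner
  integrals. Positivity of \<open>c\<close> is essential, since 0 times infinity is 0 in
  \<open>ennreal\<close>.\<close>

lemma integral_le_of_nn_integral_le:
  fixes f :: "'a \<Rightarrow> real"
  assumes [measurable]: "f \<in> borel_measurable M" and f0: "AE \<omega> in M. 0 \<le> f \<omega>"
    and le: "ennreal c * (\<integral>\<^sup>+\<omega>. ennreal (f \<omega>) \<partial>M) \<le> ennreal C" and c: "0 < c" and C: "0 \<le> C"
  shows "integrable M f" "c * (\<integral>\<omega>. f \<omega> \<partial>M) \<le> C"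
proof -
  have "(\<integral>\<^sup>+\<omega>. ennreal (f \<omega>) \<partial>M) \<noteq> \<infinity>"
  proof
    assume "(\<integral>\<^sup>+\<omega>. ennreal (f \<omega>) \<partial>M) = \<infinity>"
    with le c show False by (simp add: ennreal_mult_top top_unique)
  qed
  then show i: "integrable M f"
    by (intro integrableI_nonneg) (use f0 in \<open>auto simp: top.not_eq_extremum\<close>)
  have "ennreal (c * (\<integral>\<omega>. f \<omega> \<partial>M)) \<le> ennreal C"
    using le c by (simp add: ennreal_mult' nn_integral_eq_integral[OF i f0])
  then show "c * (\<integral>\<omega>. f \<omega> \<partial>M) \<le> C" using C by (simp add: ennreal_le_iff)
qed

text \<open>Smoothing over the length l = \<alpha>/\<rho> costs \<alpha>/\<rho>. The terms with
  \<open>C1\<close> and 6 \<open>C2\<close> come from the covariance and the smooth part of the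
  Stein remainder. The overlap contributes 2 \<open>C3\<close>/\<alpha> outside \<open>A\<close>
  and, on \<open>A\<close>, the terms from \<kappa> times the interval length 3 l + 2 b and from
  \<eta>. The essential point is the coefficient of \<eta>: it carries no factor 1/\<rho>, but
  becomes small when \<alpha> is large.\<close>

lemma (in prob_space) size_bias_Kolmogorov_step:
  fixes Y Ys K V B :: "'a \<Rightarrow> real"
  defines "\<mu> \<equiv> expectation Y" and "\<sigma> \<equiv> sqrt (variance Y)"
  defines "W \<equiv> \<lambda>\<omega>. (Y \<omega> - \<mu>) / \<sigma>"
  assumes sb: "size_bias M Y Ys"
    and Y2: "integrable M (\<lambda>\<omega>. (Y \<omega>)\<^sup>2)" and var: "0 < variance Y"
    and sub: "subalgebra M G"
    and K: "K \<in> borel_measurable G" and B: "B \<in> borel_measurable G" and A: "A \<in> sets G"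
    and V[measurable]: "V \<in> borel_measurable M"
    and K_bound: "AE \<omega> in M. \<bar>Ys \<omega> - Y \<omega>\<bar> \<le> K \<omega>"
    and B_bound: "AE \<omega> in M. \<bar>Y \<omega> - V \<omega>\<bar> \<le> B \<omega>"
    and cond: "\<And>p q. p \<le> q \<Longrightarrow> AE \<omega> in M. \<omega> \<in> A \<longrightarrow>
        real_cond_exp M G (\<lambda>\<omega>. indicator {p<..q} ((V \<omega> - \<mu>) / \<sigma>)) \<omega> \<le> \<kappa> * (q - p) + \<eta>"
    and \<kappa>: "0 \<le> \<kappa>" and \<eta>: "0 \<le> \<eta>" and \<rho>: "0 < \<rho>" and \<alpha>: "0 < \<alpha>"
    and C: "0 \<le> C2" "0 \<le> C3" "0 \<le> C5"
    and C1: "\<rho> * \<mu> * sqrt (variance (cond_exp_given M Y (\<lambda>\<omega>. Ys \<omega> - Y \<omega>))) / \<sigma>\<^sup>2 \<le> C1"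
    and C2: "ennreal (\<rho> * \<mu> / \<sigma> ^ 3) * (\<integral>\<^sup>+ \<omega>. ennreal ((1 + \<bar>W \<omega>\<bar>) * (K \<omega>)\<^sup>2) \<partial>M) \<le> ennreal C2"
    and C3: "ennreal (\<rho>\<^sup>2 * \<mu> / \<sigma> ^ 3) * (\<integral>\<^sup>+ \<omega>. ennreal ((K \<omega>)\<^sup>2 * (1 - indicator A \<omega>)) \<partial>M) \<le> ennreal C3"
    and C5: "ennreal (\<rho>\<^sup>2 * \<mu> / \<sigma> ^ 4) * (\<integral>\<^sup>+ \<omega>. ennreal ((K \<omega>)\<^sup>2 * B \<omega>) \<partial>M) \<le> ennreal C5"
  shows "\<bar>prob {\<omega> \<in> space M. W \<omega> \<le> z} - Phi z\<bar>
    \<le> (\<alpha> + 2 * C1 + 6 * C2 + 2 * C3 / \<alpha> + 6 * \<kappa> * C2 + 4 * \<kappa> * C5 / \<alpha>) / \<rho> + 2 * C2 / \<alpha> * \<eta>"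
proof -
  have [measurable]: "Y \<in> borel_measurable M" "Ys \<in> borel_measurable M"
    and Y0: "AE \<omega> in M. 0 \<le> Y \<omega>" and "\<mu> \<noteq> 0"
    using sb by (auto simp: size_bias_def \<mu>_def)
  have "0 \<le> \<mu>" unfolding \<mu>_def by (rule integral_nonneg_AE[OF Y0])
  with \<open>\<mu> \<noteq> 0\<close> have \<mu>: "0 < \<mu>" by simp
  have \<sigma>: "0 < \<sigma>" using var by (simp add: \<sigma>_def)
  have [measurable]: "W \<in> borel_measurable M" unfolding W_def by measurable
  have [measurable]: "K \<in> borel_measurable M" "B \<in> borel_measurable M" "A \<in> sets M"
    using K B A sub by (auto intro: measurable_from_subalg simp: subalgebra_def)
  have K0: "AE \<omega> in M. 0 \<le> K \<omega>" using K_bound by eventually_elim linarith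
  have B0: "AE \<omega> in M. 0 \<le> B \<omega>" using B_bound by eventually_elim linarith
  have c2: "0 < \<rho> * \<mu> / \<sigma> ^ 3" and c3: "0 < \<rho>\<^sup>2 * \<mu> / \<sigma> ^ 3" and c5: "0 < \<rho>\<^sup>2 * \<mu> / \<sigma> ^ 4"
    using \<rho> \<mu> \<sigma> by auto
  define I2 where "I2 = (\<integral>\<omega>. (1 + \<bar>W \<omega>\<bar>) * (K \<omega>)\<^sup>2 \<partial>M)"
  define I3 where "I3 = (\<integral>\<omega>. (K \<omega>)\<^sup>2 * (1 - indicator A \<omega>) \<partial>M)"
  define I5 where "I5 = (\<integral>\<omega>. (K \<omega>)\<^sup>2 * B \<omega> \<partial>M)"
  define I1 where "I1 = (\<integral>\<omega>. (K \<omega>)\<^sup>2 \<partial>M)"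
  have i2: "integrable M (\<lambda>\<omega>. (1 + \<bar>W \<omega>\<bar>) * (K \<omega>)\<^sup>2)" and I2: "\<rho> * \<mu> / \<sigma> ^ 3 * I2 \<le> C2"
    unfolding I2_def by (rule integral_le_of_nn_integral_le[OF _ _ C2 c2 C(1)]; auto)+
  have i3: "integrable M (\<lambda>\<omega>. (K \<omega>)\<^sup>2 * (1 - indicator A \<omega>))" and I3: "\<rho>\<^sup>2 * \<mu> / \<sigma> ^ 3 * I3 \<le> C3"
    unfolding I3_def by (rule integral_le_of_nn_integral_le[OF _ _ C3 c3 C(2)]; auto simp: indicator_def)+
  have i5: "integrable M (\<lambda>\<omega>. (K \<omega>)\<^sup>2 * B \<omega>)" and I5: "\<rho>\<^sup>2 * \<mu> / \<sigma> ^ 4 * I5 \<le> C5"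
    unfolding I5_def by (rule integral_le_of_nn_integral_le[OF _ _ C5 c5 C(3)]; use B0 in auto)+
  have i1: "integrable M (\<lambda>\<omega>. (K \<omega>)\<^sup>2)"
    by (rule Bochner_Integration.integrable_bound[OF i2]) (auto simp: abs_mult distrib_right)
  have "I1 \<le> I2" unfolding I1_def I2_def
    by (intro integral_mono i1 i2) (auto simp: distrib_right)
  then have I1: "\<rho> * \<mu> / \<sigma> ^ 3 * I1 \<le> C2" using I2 c2 by (meson mult_left_mono less_imp_le order_trans)
  define l where "l = \<alpha> / \<rho>"
  have l: "0 < l" using \<alpha> \<rho> by (simp add: l_def)
  \<comment> \<open>\<open>K\<close> and \<open>B\<close> are nonnegative only almost surely,
    whereas \<open>nn_integral_overlap_le\<close> asks for nonnegativity everywhere. Truncation at 0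
    keeps measurability in \<open>G\<close> and changes nothing up to null sets.\<close>
  define k where "k \<omega> = max 0 (K \<omega> / \<sigma>)" for \<omega>
  define b where "b \<omega> = max 0 (B \<omega> / \<sigma>)" for \<omega>
  have k: "k \<in> borel_measurable G" and b: "b \<in> borel_measurable G"
    unfolding k_def b_def using K B by measurable
  have kK: "AE \<omega> in M. k \<omega> = K \<omega> / \<sigma>"
    using K0 by eventually_elim (use \<sigma> in \<open>simp add: k_def\<close>)
  have bB: "AE \<omega> in M. b \<omega> = B \<omega> / \<sigma>"
    using B0 by eventually_elim (use \<sigma> in \<open>simp add: b_def\<close>)
  have WV: "AE \<omega> in M. \<bar>W \<omega> - (V \<omega> - \<mu>) / \<sigma>\<bar> \<le> b \<omega>"
    using B_bound bB
  proof eventually_elim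
    case (elim \<omega>)
    have "W \<omega> - (V \<omega> - \<mu>) / \<sigma> = (Y \<omega> - V \<omega>) / \<sigma>" by (simp add: W_def diff_divide_distrib)
    then show ?case using elim \<sigma> by (simp add: divide_right_mono)
  qed
  have [measurable]: "k \<in> borel_measurable M" "b \<in> borel_measurable M"
    using k b sub by (auto intro: measurable_from_subalg)
  \<comment> \<open>An integrable majorant in terms of \<open>K\<close> and \<open>B\<close>. It
    agrees with the concentration bound on \<open>A\<close>; outside \<open>A\<close> it adds
    nonnegative terms, so that the indicator of \<open>A\<close> survives in the first summand
    only.\<close>
  let ?g = "\<lambda>\<omega>. 2 / \<sigma>\<^sup>2 * ((K \<omega>)\<^sup>2 * (1 - indicator A \<omega>)) + (6 * \<kappa> * l + 2 * \<eta>) / \<sigma>\<^sup>2 * (K \<omega>)\<^sup>2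
    + 4 * \<kappa> / \<sigma> ^ 3 * ((K \<omega>)\<^sup>2 * B \<omega>)"
  have ig: "integrable M ?g"
    by (intro Bochner_Integration.integrable_add integrable_mult_right i1 i3 i5)
  have Eg: "(\<integral>\<omega>. ?g \<omega> \<partial>M) = 2 / \<sigma>\<^sup>2 * I3 + (6 * \<kappa> * l + 2 * \<eta>) / \<sigma>\<^sup>2 * I1 + 4 * \<kappa> / \<sigma> ^ 3 * I5"
    unfolding I1_def I3_def I5_def
    by (simp only: Bochner_Integration.integral_add integrable_mult_right i1 i3 i5
        integral_mult_right_zero Bochner_Integration.integrable_add)
  have g0: "AE \<omega> in M. 0 \<le> ?g \<omega>"
    using B0 by eventually_elim (use \<sigma> \<kappa> \<eta> l in \<open>auto simp: indicator_def intro!: add_nonneg_nonneg mult_nonneg_nonneg divide_nonneg_nonneg\<close>)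
  have ov: "(\<integral>\<omega>. K \<omega> / \<sigma> * overlap (K \<omega> / \<sigma>) (z - W \<omega>) (z + l - W \<omega>) \<partial>M)
      \<le> 2 / \<sigma>\<^sup>2 * I3 + (6 * \<kappa> * l + 2 * \<eta>) / \<sigma>\<^sup>2 * I1 + 4 * \<kappa> / \<sigma> ^ 3 * I5" for z
  proof -
    let ?X = "\<lambda>\<omega>. K \<omega> / \<sigma> * overlap (K \<omega> / \<sigma>) (z - W \<omega>) (z + l - W \<omega>)"
    have iX: "integrable M ?X"
      unfolding W_def \<mu>_def \<sigma>_def
      by (rule size_bias_Stein_bound(1)[OF sb Y2 var _ K_bound _ l])
        (use i2 in \<open>simp_all add: W_def \<mu>_def \<sigma>_def\<close>)
    have X0: "AE \<omega> in M. 0 \<le> ?X \<omega>"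
      using K0 by eventually_elim (use \<sigma> in \<open>auto simp: overlap_def\<close>)
    have "ennreal (\<integral>\<omega>. ?X \<omega> \<partial>M) = (\<integral>\<^sup>+\<omega>. ennreal (?X \<omega>) \<partial>M)"
      by (rule nn_integral_eq_integral[OF iX X0, symmetric])
    also have "\<dots> = (\<integral>\<^sup>+\<omega>. ennreal (k \<omega> * overlap (k \<omega>) (z - W \<omega>) (z + l - W \<omega>)) \<partial>M)"
      by (rule nn_integral_cong_AE) (use kK in \<open>eventually_elim, simp\<close>)
    also have "\<dots> \<le> (\<integral>\<^sup>+\<omega>. ennreal (2 * (k \<omega>)\<^sup>2 * (1 - indicator A \<omega>)) \<partial>M)
      + (\<integral>\<^sup>+\<omega>. ennreal (2 * (k \<omega>)\<^sup>2) * indicator A \<omega> * ennreal (\<kappa> * (3 * l + 2 * b \<omega>) + \<eta>) \<partial>M)"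
      by (rule nn_integral_overlap_le[OF sub _ _ k b A _ _ l \<kappa> WV cond]) (auto simp: k_def b_def)
    also have "\<dots> = (\<integral>\<^sup>+\<omega>. ennreal (2 * (k \<omega>)\<^sup>2 * (1 - indicator A \<omega>))
      + ennreal (2 * (k \<omega>)\<^sup>2) * indicator A \<omega> * ennreal (\<kappa> * (3 * l + 2 * b \<omega>) + \<eta>) \<partial>M)"
      by (rule nn_integral_add[symmetric]) measurable
    also have "\<dots> \<le> (\<integral>\<^sup>+\<omega>. ennreal (?g \<omega>) \<partial>M)"
    proof (rule nn_integral_mono_AE)
      show "AE \<omega> in M. ennreal (2 * (k \<omega>)\<^sup>2 * (1 - indicator A \<omega>))
        + ennreal (2 * (k \<omega>)\<^sup>2) * indicator A \<omega> * ennreal (\<kappa> * (3 * l + 2 * b \<omega>) + \<eta>) \<le> ennreal (?g \<omega>)"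
        using kK bB B0
      proof eventually_elim
        case (elim \<omega>)
        show ?case
        proof (cases "\<omega> \<in> A")
          case True
          have "0 \<le> \<kappa> * (3 * l + 2 * b \<omega>) + \<eta>"
            using \<kappa> \<eta> l by (auto simp: b_def intro!: add_nonneg_nonneg mult_nonneg_nonneg)
          moreover have "2 * (k \<omega>)\<^sup>2 * (\<kappa> * (3 * l + 2 * b \<omega>) + \<eta>) = ?g \<omega>"
          proof -
            have KB: "K \<omega> = k \<omega> * \<sigma>" "B \<omega> = b \<omega> * \<sigma>" using elim \<sigma> by simp_all
            show ?thesis unfolding KB using True \<sigma> by (simp add: field_simps power2_eq_square power3_eq_cube)
          qed
          ultimately show ?thesis using True by (simp flip: ennreal_mult)
        next
          case False
          have "0 \<le> (6 * \<kappa> * l + 2 * \<eta>) / \<sigma>\<^sup>2 * (K \<omega>)\<^sup>2" "0 \<le> 4 * \<kappa> / \<sigma> ^ 3 * ((K \<omega>)\<^sup>2 * B \<omega>)"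
            using \<kappa> \<eta> l \<sigma> elim by auto
          moreover have "2 * (k \<omega>)\<^sup>2 = 2 / \<sigma>\<^sup>2 * (K \<omega>)\<^sup>2" using elim by (simp add: power_divide)
          ultimately have "2 * (k \<omega>)\<^sup>2 \<le> ?g \<omega>" using False by simp
          then show ?thesis using False by (simp add: ennreal_leI)
        qed
      qed
    qed
    also have "\<dots> = ennreal (\<integral>\<omega>. ?g \<omega> \<partial>M)" by (rule nn_integral_eq_integral[OF ig g0])
    finally have "(\<integral>\<omega>. ?X \<omega> \<partial>M) \<le> (\<integral>\<omega>. ?g \<omega> \<partial>M)"
      using integral_nonneg_AE[OF g0] by (simp add: ennreal_le_iff)
    then show ?thesis unfolding Eg .
  qed
  have "\<bar>(\<integral>\<omega>. ramp z l (W \<omega>) \<partial>M) - (\<integral>x. ramp z l x * std_normal_density x \<partial>lborel)\<bar>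
      \<le> (2 * C1 + 6 * C2 + 2 * C3 / \<alpha> + 6 * \<kappa> * C2 + 4 * \<kappa> * C5 / \<alpha>) / \<rho> + 2 * C2 / \<alpha> * \<eta>" for z
  proof -
    let ?X = "\<integral>\<omega>. K \<omega> / \<sigma> * overlap (K \<omega> / \<sigma>) (z - W \<omega>) (z + l - W \<omega>) \<partial>M"
    let ?\<Psi> = "sqrt (variance (cond_exp_given M Y (\<lambda>\<omega>. Ys \<omega> - Y \<omega>)))"
    have "\<bar>(\<integral>\<omega>. ramp z l (W \<omega>) \<partial>M) - (\<integral>x. ramp z l x * std_normal_density x \<partial>lborel)\<bar>
      \<le> 2 * \<mu> / \<sigma>\<^sup>2 * ?\<Psi> + 6 * \<mu> / \<sigma>^3 * I2 + \<mu> / (\<sigma> * l) * ?X"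
      unfolding W_def \<mu>_def \<sigma>_def I2_def
      by (rule size_bias_Stein_bound(2)[OF sb Y2 var _ K_bound _ l])
        (use i2 in \<open>simp_all add: W_def \<mu>_def \<sigma>_def\<close>)
    also have "2 * \<mu> / \<sigma>\<^sup>2 * ?\<Psi> = 2 * (\<rho> * \<mu> * ?\<Psi> / \<sigma>\<^sup>2) / \<rho>"
      using \<rho> by simp
    also have "\<dots> \<le> 2 * C1 / \<rho>" using C1 \<rho> by (intro divide_right_mono mult_left_mono) auto
    also have "6 * \<mu> / \<sigma>^3 * I2 = 6 * (\<rho> * \<mu> / \<sigma>^3 * I2) / \<rho>" using \<rho> by simp
    also have "\<dots> \<le> 6 * C2 / \<rho>" using I2 \<rho> by (intro divide_right_mono mult_left_mono) auto
    also have "\<mu> / (\<sigma> * l) * ?X \<le> \<mu> / (\<sigma> * l) * (2 / \<sigma>\<^sup>2 * I3 + (6 * \<kappa> * l + 2 * \<eta>) / \<sigma>\<^sup>2 * I1 + 4 * \<kappa> / \<sigma> ^ 3 * I5)"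
      by (intro mult_left_mono ov) (use \<mu> \<sigma> l in auto)
    \<comment> \<open>The factor 1/l = \<rho>/\<alpha> supplies the second power of \<rho> in
      \<open>C3\<close> and \<open>C5\<close>. In the term 6 \<kappa> l it cancels against l, and in
      the \<eta> term it supplies the power of \<rho> in \<open>C2\<close>.\<close>
    also have "\<dots> = 2 / \<alpha> * (\<rho>\<^sup>2 * \<mu> / \<sigma> ^ 3 * I3) / \<rho> + (6 * \<kappa> / \<rho> + 2 * \<eta> / \<alpha>) * (\<rho> * \<mu> / \<sigma> ^ 3 * I1)
        + 4 * \<kappa> / \<alpha> * (\<rho>\<^sup>2 * \<mu> / \<sigma> ^ 4 * I5) / \<rho>"
      using \<rho> \<sigma> \<alpha> unfolding l_def by (simp add: field_simps power2_eq_square power3_eq_cube power4_eq_xxxx)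
    also have "\<dots> \<le> 2 / \<alpha> * C3 / \<rho> + (6 * \<kappa> / \<rho> + 2 * \<eta> / \<alpha>) * C2 + 4 * \<kappa> / \<alpha> * C5 / \<rho>"
      by (intro add_mono divide_right_mono mult_left_mono I1 I3 I5) (use \<rho> \<alpha> \<kappa> \<eta> in auto)
    finally show ?thesis by (simp add: add_divide_distrib distrib_left distrib_right mult_ac add_ac)
  qed
  from Kolmogorov_distance_le_ramp[OF _ l this, of z]
  show ?thesis by (simp add: l_def add_divide_distrib)
qed

text \<open>The probability is a difference of two values of the distribution function, each within
  e of the normal one, and \<open>Phi\<close> is 1-Lipschitz in the standardized variable.\<close>

lemma prob_interval_le_of_Kolmogorov:
  fixes Y :: "'a \<Rightarrow> real"
  assumes "prob_space M" and [measurable]: "Y \<in> borel_measurable M"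
    and d: "\<And>z. \<bar>measure M {\<omega> \<in> space M. (Y \<omega> - m) / s \<le> z} - Phi z\<bar> \<le> e"
    and s: "0 < s" and pq: "p \<le> q"
  shows "measure (distr M borel Y) {p<..q} \<le> (q - p) / s + 2 * e"
proof -
  interpret prob_space M by fact
  let ?D = "\<lambda>x. {\<omega> \<in> space M. (Y \<omega> - m) / s \<le> (x - m) / s}"
  have D: "?D x = {\<omega> \<in> space M. Y \<omega> \<le> x}" for x
    using s by (simp add: divide_le_cancel)
  have "measure (distr M borel Y) {p<..q} = prob (?D q - ?D p)"
    unfolding D by (subst measure_distr) (auto intro!: arg_cong[where f=prob])
  also have "\<dots> = prob (?D q) - prob (?D p)"
    by (rule finite_measure_Diff) (use pq in \<open>auto simp: D\<close>)
  also have "\<dots> \<le> Phi ((q - m) / s) - Phi ((p - m) / s) + 2 * e"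
    using d[of "(q - m) / s"] d[of "(p - m) / s"] by linarith
  also have "\<dots> \<le> (q - m) / s - (p - m) / s + 2 * e"
    by (intro add_right_mono Phi_diff_le divide_right_mono) (use pq s in auto)
  finally show ?thesis by (simp add: diff_divide_distrib)
qed

section \<open>The generated subalgebra and uniform constants from finite suprema\<close>

lemma subalgebra_generated_algebra:
  assumes "\<And>i. i \<in> I \<Longrightarrow> J i \<in> measurable M (N i)"
  shows "subalgebra M (generated_algebra M I J N)"
proof -
  have s: "(\<Union>i\<in>I. {J i -` A \<inter> space M | A. A \<in> sets (N i)}) \<subseteq> sets M"
    using assms by (auto intro: measurable_sets)
  then have "(\<Union>i\<in>I. {J i -` A \<inter> space M | A. A \<in> sets (N i)}) \<subseteq> Pow (space M)"
    using sets.space_closed by blast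
  with s show ?thesis
    unfolding subalgebra_def generated_algebra_def
    by (simp add: space_measure_of_conv sets_measure_of sets.sigma_sets_subset)
qed

lemma ennreal_SUP2_lt_topE:
  fixes f :: "'i \<Rightarrow> 'j \<Rightarrow> ennreal"
  assumes "(SUP n\<in>A. SUP \<theta>\<in>T n. f n \<theta>) < \<infinity>"
  obtains C where "0 \<le> C" "\<And>n \<theta>. n \<in> A \<Longrightarrow> \<theta> \<in> T n \<Longrightarrow> f n \<theta> \<le> ennreal C"
proof -
  obtain C where C: "0 \<le> C" "(SUP n\<in>A. SUP \<theta>\<in>T n. f n \<theta>) = ennreal C"
    using assms by (cases "SUP n\<in>A. SUP \<theta>\<in>T n. f n \<theta>") auto
  show ?thesis
  proof (rule that[OF C(1)])
    fix n \<theta> assume n: "n \<in> A" and \<theta>: "\<theta> \<in> T n"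
    have "f n \<theta> \<le> (SUP \<theta>\<in>T n. f n \<theta>)" using \<theta> by (rule SUP_upper)
    also have "\<dots> \<le> (SUP n\<in>A. SUP \<theta>\<in>T n. f n \<theta>)" using n by (rule SUP_upper)
    finally show "f n \<theta> \<le> ennreal C" unfolding C(2) .
  qed
qed

theorem theorem1p1:
  fixes n0 n1 :: nat and r1 c1 c2 :: real
    and Theta :: "nat \<Rightarrow> 't topology"
    and M :: "nat \<Rightarrow> 't \<Rightarrow> 'w measure"
    and Y W :: "nat \<Rightarrow> 't \<Rightarrow> 'w \<Rightarrow> real"
    and mu sigma r Psi :: "nat \<Rightarrow> 't \<Rightarrow> real"
    and Theta1 :: "nat \<Rightarrow> 't set"
    and Ys K V B :: "nat \<Rightarrow> 't \<Rightarrow> 'w \<Rightarrow> real"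
    and L :: "nat \<Rightarrow> 't \<Rightarrow> 'w \<Rightarrow> nat"
    and psi :: "nat \<Rightarrow> 't \<Rightarrow> 'w \<Rightarrow> 't"
    and I :: "nat \<Rightarrow> 't \<Rightarrow> 'i set"
    and J :: "nat \<Rightarrow> 't \<Rightarrow> 'i \<Rightarrow> 'w \<Rightarrow> 'e"
    and N :: "nat \<Rightarrow> 't \<Rightarrow> 'i \<Rightarrow> 'e measure"
    and G :: "nat \<Rightarrow> 't \<Rightarrow> 'w measure"
    and F :: "nat \<Rightarrow> 't \<Rightarrow> 'w set"
    and s :: "nat \<Rightarrow> 't \<Rightarrow> nat"
    and t :: "nat \<Rightarrow> 't \<Rightarrow> nat \<Rightarrow> real"
  assumes mu_def: "mu = (\<lambda>n \<theta>. prob_space.expectation (M n \<theta>) (Y n \<theta>))"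
    and sigma_def: "sigma = (\<lambda>n \<theta>. sqrt (prob_space.variance (M n \<theta>) (Y n \<theta>)))"
    and W_def: "W = (\<lambda>n \<theta> \<omega>. (Y n \<theta> \<omega> - mu n \<theta>) / sigma n \<theta>)"
    and Theta1_def: "Theta1 = (\<lambda>n. {\<theta> \<in> topspace (Theta n). r1 \<le> r n \<theta>})"
    and G_def: "G = (\<lambda>n \<theta>. generated_algebra (M n \<theta>) (I n \<theta>) (J n \<theta>) (N n \<theta>))"
    and Psi_def: "Psi = (\<lambda>n \<theta>. sqrt (prob_space.variance (M n \<theta>)
          (cond_exp_given (M n \<theta>) (Y n \<theta>) (\<lambda>\<omega>. Ys n \<theta> \<omega> - Y n \<theta> \<omega>))))"
    and t_def: "t = (\<lambda>n \<theta> l. prob_space.expectation (M n \<theta>)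
          (\<lambda>\<omega>. (K n \<theta> \<omega>)\<^sup>2 / prob_space.expectation (M n \<theta>) (\<lambda>\<omega>'. (K n \<theta> \<omega>')\<^sup>2)
                * indicator {\<omega>'. L n \<theta> \<omega>' = l} \<omega>))"
    \<comment> \<open>framework\<close>
    and prob: "\<And>n \<theta>. n0 \<le> n \<Longrightarrow> \<theta> \<in> topspace (Theta n) \<Longrightarrow> prob_space (M n \<theta>)"
    and Y_rv: "\<And>n \<theta>. n0 \<le> n \<Longrightarrow> \<theta> \<in> topspace (Theta n) \<Longrightarrow> Y n \<theta> \<in> borel_measurable (M n \<theta>)"
    and Y_nonneg: "\<And>n \<theta>. n0 \<le> n \<Longrightarrow> \<theta> \<in> topspace (Theta n) \<Longrightarrow> AE \<omega> in M n \<theta>. 0 \<le> Y n \<theta> \<omega>"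
    and Y_sq_int: "\<And>n \<theta>. n0 \<le> n \<Longrightarrow> \<theta> \<in> topspace (Theta n) \<Longrightarrow>
          integrable (M n \<theta>) (\<lambda>\<omega>. (Y n \<theta> \<omega>)\<^sup>2)"
    and var_pos: "\<And>n \<theta>. n0 \<le> n \<Longrightarrow> \<theta> \<in> topspace (Theta n) \<Longrightarrow>
          0 < prob_space.variance (M n \<theta>) (Y n \<theta>)"
    and r_pos: "\<And>n \<theta>. n0 \<le> n \<Longrightarrow> \<theta> \<in> topspace (Theta n) \<Longrightarrow> 0 < r n \<theta>"
    and mu_meas: "\<And>n. n0 \<le> n \<Longrightarrow> mu n \<in> borel_measurable (borel_of (Theta n))"
    and var_meas: "\<And>n. n0 \<le> n \<Longrightarrow> (\<lambda>\<theta>. (sigma n \<theta>)\<^sup>2) \<in> borel_measurable (borel_of (Theta n))"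
    and r_meas: "\<And>n. n0 \<le> n \<Longrightarrow> r n \<in> borel_measurable (borel_of (Theta n))"
    and r1_pos: "0 < r1" and n1_ge: "n0 \<le> n1"
    and r_bdd: "(SUP n\<in>{n0..<n1}. SUP \<theta>\<in>Theta1 n. ennreal (r n \<theta>)) < \<infinity>"
    and J_rv: "\<And>n \<theta> i. n1 \<le> n \<Longrightarrow> \<theta> \<in> Theta1 n \<Longrightarrow> i \<in> I n \<theta> \<Longrightarrow>
          J n \<theta> i \<in> measurable (M n \<theta>) (N n \<theta> i)"
    \<comment> \<open>(1)\<close>
    and Ys_size_bias: "\<And>n \<theta>. n1 \<le> n \<Longrightarrow> \<theta> \<in> Theta1 n \<Longrightarrow> size_bias (M n \<theta>) (Y n \<theta>) (Ys n \<theta>)"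
    and Psi_bdd: "(SUP n\<in>{n1..}. SUP \<theta>\<in>Theta1 n.
          ennreal (r n \<theta> * mu n \<theta> * Psi n \<theta> / (sigma n \<theta>)\<^sup>2)) < \<infinity>"
    \<comment> \<open>(2)\<close>
    and K_meas: "\<And>n \<theta>. n1 \<le> n \<Longrightarrow> \<theta> \<in> Theta1 n \<Longrightarrow> K n \<theta> \<in> borel_measurable (G n \<theta>)"
    and K_bound: "\<And>n \<theta>. n1 \<le> n \<Longrightarrow> \<theta> \<in> Theta1 n \<Longrightarrow>
          AE \<omega> in M n \<theta>. \<bar>Ys n \<theta> \<omega> - Y n \<theta> \<omega>\<bar> \<le> K n \<theta> \<omega>"
    and K_bdd: "(SUP n\<in>{n1..}. SUP \<theta>\<in>Theta1 n.
          ennreal (r n \<theta> * mu n \<theta> / (sigma n \<theta>) ^ 3) *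
          (\<integral>\<^sup>+ \<omega>. ennreal ((1 + \<bar>W n \<theta> \<omega>\<bar>) * (K n \<theta> \<omega>)\<^sup>2) \<partial>M n \<theta>)) < \<infinity>"
    \<comment> \<open>(3)\<close>
    and s_pos: "\<And>n \<theta>. n1 \<le> n \<Longrightarrow> \<theta> \<in> Theta1 n \<Longrightarrow> 0 < s n \<theta> \<and> n0 + s n \<theta> \<le> n"
    and L_meas: "\<And>n \<theta>. n1 \<le> n \<Longrightarrow> \<theta> \<in> Theta1 n \<Longrightarrow>
          L n \<theta> \<in> measurable (G n \<theta>) (count_space {0..n})"
    and F_event: "\<And>n \<theta>. n1 \<le> n \<Longrightarrow> \<theta> \<in> Theta1 n \<Longrightarrow>
          F n \<theta> \<in> sets (G n \<theta>) \<and> F n \<theta> \<subseteq> {\<omega> \<in> space (M n \<theta>). L n \<theta> \<omega> \<le> s n \<theta>}"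
    and psi_in: "\<And>n \<theta> \<omega>. n1 \<le> n \<Longrightarrow> \<theta> \<in> Theta1 n \<Longrightarrow> \<omega> \<in> F n \<theta> \<Longrightarrow>
          psi n \<theta> \<omega> \<in> topspace (Theta (n - L n \<theta> \<omega>))"
    and psi_meas: "\<And>n \<theta> l. n1 \<le> n \<Longrightarrow> \<theta> \<in> Theta1 n \<Longrightarrow> l \<le> s n \<theta> \<Longrightarrow>
          psi n \<theta> \<in> measurable (restrict_space (G n \<theta>) {\<omega> \<in> F n \<theta>. L n \<theta> \<omega> = l})
                      (borel_of (Theta (n - l)))"
    and V_rv: "\<And>n \<theta>. n1 \<le> n \<Longrightarrow> \<theta> \<in> Theta1 n \<Longrightarrow> V n \<theta> \<in> borel_measurable (M n \<theta>)"
    and V_cond: "\<And>n \<theta>. n1 \<le> n \<Longrightarrow> \<theta> \<in> Theta1 n \<Longrightarrow>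
          cond_dist_on (M n \<theta>) (G n \<theta>) (V n \<theta>) (F n \<theta>)
            (\<lambda>\<omega>. distr (M (n - L n \<theta> \<omega>) (psi n \<theta> \<omega>)) borel (Y (n - L n \<theta> \<omega>) (psi n \<theta> \<omega>)))"
    and F_bdd: "(SUP n\<in>{n1..}. SUP \<theta>\<in>Theta1 n.
          ennreal ((r n \<theta>)\<^sup>2 * mu n \<theta> / (sigma n \<theta>) ^ 3) *
          (\<integral>\<^sup>+ \<omega>. ennreal ((K n \<theta> \<omega>)\<^sup>2 * (1 - indicator (F n \<theta>) \<omega>)) \<partial>M n \<theta>)) < \<infinity>"
    \<comment> \<open>(4)\<close>
    and c_pos: "0 < c1" "0 < c2"
    and sigma_comp: "\<And>n \<theta>. n1 \<le> n \<Longrightarrow> \<theta> \<in> Theta1 n \<Longrightarrow> AE \<omega> in M n \<theta>. \<omega> \<in> F n \<theta> \<longrightarrow>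
          (sigma n \<theta>)\<^sup>2 \<le> c1 * (sigma (n - L n \<theta> \<omega>) (psi n \<theta> \<omega>))\<^sup>2"
    and r_comp: "\<And>n \<theta>. n1 \<le> n \<Longrightarrow> \<theta> \<in> Theta1 n \<Longrightarrow> AE \<omega> in M n \<theta>. \<omega> \<in> F n \<theta> \<longrightarrow>
          r n \<theta> \<le> c2 * r (n - L n \<theta> \<omega>) (psi n \<theta> \<omega>)"
    \<comment> \<open>(5)\<close>
    and B_meas: "\<And>n \<theta>. n1 \<le> n \<Longrightarrow> \<theta> \<in> Theta1 n \<Longrightarrow> B n \<theta> \<in> borel_measurable (G n \<theta>)"
    and B_bound: "\<And>n \<theta>. n1 \<le> n \<Longrightarrow> \<theta> \<in> Theta1 n \<Longrightarrow>
          AE \<omega> in M n \<theta>. \<bar>Y n \<theta> \<omega> - V n \<theta> \<omega>\<bar> \<le> B n \<theta> \<omega>"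
    and B_bdd: "(SUP n\<in>{n1..}. SUP \<theta>\<in>Theta1 n.
          ennreal ((r n \<theta>)\<^sup>2 * mu n \<theta> / (sigma n \<theta>) ^ 4) *
          (\<integral>\<^sup>+ \<omega>. ennreal ((K n \<theta> \<omega>)\<^sup>2 * B n \<theta> \<omega>) \<partial>M n \<theta>)) < \<infinity>"
    \<comment> \<open>(6)\<close>
    and alternatives: "\<And>n. n1 \<le> n \<Longrightarrow>
          (\<exists>l0\<in>{0..n}. \<forall>\<theta>\<in>Theta1 n. \<P>(\<omega> in M n \<theta>. L n \<theta> \<omega> = l0) = 1) \<or>
          (compactin (Theta n) (Theta1 n) \<and>
           (\<forall>l\<in>{0..(SUP \<theta>\<in>Theta1 n. s n \<theta>)}.
              continuous_map (subtopology (Theta n) (Theta1 n)) euclideanreal (\<lambda>\<theta>. t n \<theta> l)))"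
  shows "\<exists>C. \<forall>n\<ge>n0. \<forall>\<theta>\<in>topspace (Theta n).
           (SUP z. \<bar>\<P>(\<omega> in M n \<theta>. W n \<theta> \<omega> \<le> z) - cdf std_normal_distribution z\<bar>) \<le> C / r n \<theta>"
proof -
  interpret Z: real_distribution std_normal_distribution by (rule real_dist_normal_dist)
  have Theta1_top: "\<theta> \<in> topspace (Theta n)" if "\<theta> \<in> Theta1 n" for n \<theta>
    using that by (simp add: Theta1_def)
  have \<sigma>_pos: "0 < sigma n \<theta>" if "n0 \<le> n" "\<theta> \<in> topspace (Theta n)" for n \<theta>
    using var_pos[OF that] by (simp add: sigma_def)
  obtain R where R0: "0 \<le> R"
    and R: "\<And>n \<theta>. n \<in> {n0..<n1} \<Longrightarrow> \<theta> \<in> Theta1 n \<Longrightarrow> ennreal (r n \<theta>) \<le> ennreal R"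
    by (rule ennreal_SUP2_lt_topE[OF r_bdd]) blast
  obtain C1 where C1_0: "0 \<le> C1" and C1: "\<And>n \<theta>. n \<in> {n1..} \<Longrightarrow> \<theta> \<in> Theta1 n \<Longrightarrow>
      ennreal (r n \<theta> * mu n \<theta> * Psi n \<theta> / (sigma n \<theta>)\<^sup>2) \<le> ennreal C1"
    by (rule ennreal_SUP2_lt_topE[OF Psi_bdd]) blast
  obtain C2 where C2_0: "0 \<le> C2" and C2: "\<And>n \<theta>. n \<in> {n1..} \<Longrightarrow> \<theta> \<in> Theta1 n \<Longrightarrow>
      ennreal (r n \<theta> * mu n \<theta> / (sigma n \<theta>) ^ 3) *
        (\<integral>\<^sup>+ \<omega>. ennreal ((1 + \<bar>W n \<theta> \<omega>\<bar>) * (K n \<theta> \<omega>)\<^sup>2) \<partial>M n \<theta>) \<le> ennreal C2"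
    by (rule ennreal_SUP2_lt_topE[OF K_bdd]) blast
  obtain C3 where C3_0: "0 \<le> C3" and C3: "\<And>n \<theta>. n \<in> {n1..} \<Longrightarrow> \<theta> \<in> Theta1 n \<Longrightarrow>
      ennreal ((r n \<theta>)\<^sup>2 * mu n \<theta> / (sigma n \<theta>) ^ 3) *
        (\<integral>\<^sup>+ \<omega>. ennreal ((K n \<theta> \<omega>)\<^sup>2 * (1 - indicator (F n \<theta>) \<omega>)) \<partial>M n \<theta>) \<le> ennreal C3"
    by (rule ennreal_SUP2_lt_topE[OF F_bdd]) blast
  obtain C5 where C5_0: "0 \<le> C5" and C5: "\<And>n \<theta>. n \<in> {n1..} \<Longrightarrow> \<theta> \<in> Theta1 n \<Longrightarrow>
      ennreal ((r n \<theta>)\<^sup>2 * mu n \<theta> / (sigma n \<theta>) ^ 4) *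
        (\<integral>\<^sup>+ \<omega>. ennreal ((K n \<theta> \<omega>)\<^sup>2 * B n \<theta> \<omega>) \<partial>M n \<theta>) \<le> ennreal C5"
    by (rule ennreal_SUP2_lt_topE[OF B_bdd]) blast
  \<comment> \<open>By (4), the standard deviation at (n, \<theta>) is at most \<kappa> times the
    one at (n - L, \<psi>) on the event \<open>F\<close>.\<close>
  define \<kappa> where "\<kappa> = sqrt c1"
  \<comment> \<open>Large enough to make the coefficients in \<open>\<alpha>1\<close> and
    \<open>\<alpha>2\<close> at most 1/2, and chosen before \<open>D\<close>.\<close>
  define \<alpha> where "\<alpha> = 1 + 8 * C2 * (1 + c2)"
  define E where "E = \<alpha> + 2 * C1 + 6 * C2 + 2 * C3 / \<alpha> + 6 * \<kappa> * C2 + 4 * \<kappa> * C5 / \<alpha>"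
  define D where "D = 2 * E + r1 + R"
  have \<kappa>: "0 < \<kappa>" using c_pos by (simp add: \<kappa>_def)
  have \<alpha>: "0 < \<alpha>" unfolding \<alpha>_def using C2_0 c_pos by (intro add_pos_nonneg mult_nonneg_nonneg) auto
  have \<alpha>1: "4 * C2 / \<alpha> \<le> 1 / 2" and \<alpha>2: "4 * C2 * c2 / \<alpha> \<le> 1 / 2"
    using \<alpha> C2_0 c_pos mult_nonneg_nonneg[of C2 c2] by (simp_all add: \<alpha>_def divide_le_eq distrib_left)
  have E0: "0 \<le> E" unfolding E_def using \<alpha> \<kappa> C1_0 C2_0 C3_0 C5_0
    by (intro add_nonneg_nonneg mult_nonneg_nonneg divide_nonneg_nonneg) auto
  have D: "r1 \<le> D" "R \<le> D" "E + D / 2 \<le> D" "0 \<le> D"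
    unfolding D_def using E0 R0 r1_pos by auto
  \<comment> \<open>The induction is on \<open>k\<close> and covers all (n, \<theta>) at once, so
    the hypothesis also applies at (n - L, \<psi>) when L = 0.\<close>
  have bound: "\<bar>measure (M n \<theta>) {\<omega> \<in> space (M n \<theta>). W n \<theta> \<omega> \<le> z} - Phi z\<bar> \<le> D / r n \<theta> + (1 / 2) ^ k"
    if "n0 \<le> n" "\<theta> \<in> topspace (Theta n)" for k n \<theta> z
    using that
  proof (induction k arbitrary: n \<theta> z)
    case 0
    interpret prob_space "M n \<theta>" using 0 by (rule prob)
    have "0 \<le> D / r n \<theta>" using D r_pos[OF 0] by simp
    moreover have "0 \<le> prob {\<omega> \<in> space (M n \<theta>). W n \<theta> \<omega> \<le> z}" "prob {\<omega> \<in> space (M n \<theta>). W n \<theta> \<omega> \<le> z} \<le> 1"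
      by auto
    ultimately show ?case using Phi_nonneg[of z] Phi_le_1[of z] unfolding power_0 by linarith
  next
    case (Suc k)
    interpret prob_space "M n \<theta>" using Suc.prems by (rule prob)
    have r: "0 < r n \<theta>" using Suc.prems by (rule r_pos)
    show ?case
    proof (cases "n1 \<le> n \<and> \<theta> \<in> Theta1 n")
      case False
      \<comment> \<open>Here either r is below \<open>r1\<close>, or n is below \<open>n1\<close>
        and r is at most \<open>R\<close>; in both cases the trivial bound 1 on the distance
        suffices.\<close>
      have "r n \<theta> \<le> D"
      proof (cases "r1 \<le> r n \<theta>")
        case True
        then have \<theta>: "\<theta> \<in> Theta1 n" using Suc.prems by (simp add: Theta1_def)
        with False Suc.prems have "n \<in> {n0..<n1}" by auto
        from R[OF this \<theta>] R0 have "r n \<theta> \<le> R" by (simp add: ennreal_le_iff)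
        then show ?thesis using D by linarith
      qed (use D in linarith)
      then have "1 \<le> D / r n \<theta>" using r by (simp add: le_divide_eq)
      moreover have "0 \<le> prob {\<omega> \<in> space (M n \<theta>). W n \<theta> \<omega> \<le> z}" "prob {\<omega> \<in> space (M n \<theta>). W n \<theta> \<omega> \<le> z} \<le> 1"
        by auto
      moreover have "0 \<le> (1 / 2 :: real) ^ Suc k" by simp
      ultimately show ?thesis using Phi_nonneg[of z] Phi_le_1[of z] by linarith
    next
      case True
      then have n: "n1 \<le> n" "n \<in> {n1..}" and \<theta>: "\<theta> \<in> Theta1 n" by auto
      note F = F_event[OF n(1) \<theta>] and s = s_pos[OF n(1) \<theta>]
      have \<sigma>: "0 < sigma n \<theta>" using Suc.prems by (rule \<sigma>_pos)
      \<comment> \<open>The induction hypothesis at (n - L, \<psi>), with r there replaced through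
        (4) by r at (n, \<theta>) over \<open>c2\<close>. The result no longer depends on the values
        of L and \<psi>.\<close>
      define e where "e = D * c2 / r n \<theta> + (1 / 2) ^ k"
      have e0: "0 \<le> e" unfolding e_def using D c_pos r by (intro add_nonneg_nonneg) auto
      have sub: "subalgebra (M n \<theta>) (G n \<theta>)"
        unfolding G_def by (rule subalgebra_generated_algebra) (rule J_rv[OF n(1) \<theta>])
      have cond: "AE \<omega> in M n \<theta>. \<omega> \<in> F n \<theta> \<longrightarrow>
          real_cond_exp (M n \<theta>) (G n \<theta>) (\<lambda>\<omega>. indicator {p<..q} ((V n \<theta> \<omega> - mu n \<theta>) / sigma n \<theta>)) \<omega>
            \<le> \<kappa> * (q - p) + 2 * e" if pq: "p \<le> q" for p q
      proof -
        \<comment> \<open>The conditional law is known for V itself, so the interval is moved from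
          the standardized scale to that of V.\<close>
        let ?p = "p * sigma n \<theta> + mu n \<theta>" and ?q = "q * sigma n \<theta> + mu n \<theta>"
        let ?\<nu> = "\<lambda>\<omega>. distr (M (n - L n \<theta> \<omega>) (psi n \<theta> \<omega>)) borel (Y (n - L n \<theta> \<omega>) (psi n \<theta> \<omega>))"
        have ind: "(indicator {p<..q} ((v - mu n \<theta>) / sigma n \<theta>) :: real) = indicator {?p<..?q} v" for v
          using \<sigma> by (simp add: indicator_def pos_less_divide_eq pos_divide_le_eq less_diff_eq diff_le_eq)
        have "AE \<omega> in M n \<theta>. \<omega> \<in> F n \<theta> \<longrightarrow>
            real_cond_exp (M n \<theta>) (G n \<theta>) (\<lambda>\<omega>'. indicator {?p<..?q} (V n \<theta> \<omega>')) \<omega> = measure (?\<nu> \<omega>) {?p<..?q}"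
          using V_cond[OF n(1) \<theta>] unfolding cond_dist_on_def by auto
        then show ?thesis unfolding ind
          using sigma_comp[OF n(1) \<theta>] r_comp[OF n(1) \<theta>]
        proof eventually_elim
          case (elim \<omega>)
          show ?case
          proof
            assume \<omega>: "\<omega> \<in> F n \<theta>"
            define m where "m = n - L n \<theta> \<omega>"
            define \<psi> where "\<psi> = psi n \<theta> \<omega>"
            \<comment> \<open>On \<open>F\<close>, L is at most \<open>s n \<theta>\<close>, and
              \<open>n0 + s n \<theta> \<le> n\<close>; hence the index n - L stays in the range of
              the induction hypothesis.\<close>
            have m: "n0 \<le> m" using F s \<omega> unfolding m_def by force
            have \<psi>: "\<psi> \<in> topspace (Theta m)" unfolding m_def \<psi>_def by (rule psi_in[OF n(1) \<theta> \<omega>])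
            have \<sigma>m: "0 < sigma m \<psi>" and rm: "0 < r m \<psi>" using m \<psi> by (auto intro: \<sigma>_pos r_pos)
            have "sqrt ((sigma n \<theta>)\<^sup>2) \<le> sqrt (c1 * (sigma m \<psi>)\<^sup>2)"
              using elim \<omega> by (intro real_sqrt_le_mono) (simp add: m_def \<psi>_def)
            then have \<sigma>\<sigma>: "sigma n \<theta> \<le> \<kappa> * sigma m \<psi>"
              using \<sigma> \<sigma>m by (simp add: real_sqrt_mult \<kappa>_def)
            have "r n \<theta> \<le> c2 * r m \<psi>" using elim \<omega> by (simp add: m_def \<psi>_def)
            then have "D * r n \<theta> \<le> D * (c2 * r m \<psi>)" using D by (intro mult_left_mono)
            then have "D / r m \<psi> \<le> D * c2 / r n \<theta>" using rm r by (simp add: field_simps)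
            then have d: "\<bar>measure (M m \<psi>) {\<omega> \<in> space (M m \<psi>). (Y m \<psi> \<omega> - mu m \<psi>) / sigma m \<psi> \<le> x} - Phi x\<bar> \<le> e" for x
              using Suc.IH[OF m \<psi>, of x] unfolding e_def W_def by linarith
            have "measure (distr (M m \<psi>) borel (Y m \<psi>)) {?p<..?q} \<le> (?q - ?p) / sigma m \<psi> + 2 * e"
              by (rule prob_interval_le_of_Kolmogorov[OF prob[OF m \<psi>] Y_rv[OF m \<psi>] d \<sigma>m])
                (use pq \<sigma> in simp)
            also have "(?q - ?p) / sigma m \<psi> = (q - p) * (sigma n \<theta> / sigma m \<psi>)"
              by (simp add: algebra_simps diff_divide_distrib)
            also have "\<dots> \<le> (q - p) * \<kappa>"
              using \<sigma>\<sigma> \<sigma>m pq by (intro mult_left_mono) (simp_all add: pos_divide_le_eq)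
            finally show "real_cond_exp (M n \<theta>) (G n \<theta>) (\<lambda>\<omega>'. indicator {?p<..?q} (V n \<theta> \<omega>')) \<omega>
                \<le> \<kappa> * (q - p) + 2 * e"
              using elim(1) \<omega> by (simp add: m_def \<psi>_def mult.commute)
          qed
        qed
      qed
      have C1': "r n \<theta> * mu n \<theta> * Psi n \<theta> / (sigma n \<theta>)\<^sup>2 \<le> C1"
        using C1[OF n(2) \<theta>] C1_0 by (simp add: ennreal_le_iff)
      have "\<bar>prob {\<omega> \<in> space (M n \<theta>). W n \<theta> \<omega> \<le> z} - Phi z\<bar> \<le> E / r n \<theta> + 2 * C2 / \<alpha> * (2 * e)"
        unfolding E_def W_def mu_def sigma_def
      proof (rule size_bias_Kolmogorov_step[OF Ys_size_bias[OF n(1) \<theta>] Y_sq_int[OF Suc.prems]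
            var_pos[OF Suc.prems] sub K_meas[OF n(1) \<theta>] B_meas[OF n(1) \<theta>] conjunct1[OF F]
            V_rv[OF n(1) \<theta>] K_bound[OF n(1) \<theta>] B_bound[OF n(1) \<theta>]
            cond[unfolded mu_def sigma_def] _ _ r \<alpha> C2_0 C3_0 C5_0
            C1'[unfolded mu_def sigma_def Psi_def] C2[OF n(2) \<theta>, unfolded W_def mu_def sigma_def]
            C3[OF n(2) \<theta>, unfolded mu_def sigma_def] C5[OF n(2) \<theta>, unfolded mu_def sigma_def]])
      qed (use \<kappa> e0 in auto)
      \<comment> \<open>With \<eta> = 2 e the coefficient of e is 4 \<open>C2\<close>/\<alpha>. By
        the choice of \<alpha> at most half of D / r comes back, which E + D/2 at most D absorbs,
        and the error (1/2)^k is halved.\<close>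
      also have "2 * C2 / \<alpha> * (2 * e) = (4 * C2 * c2 / \<alpha>) * (D / r n \<theta>) + (4 * C2 / \<alpha>) * (1 / 2) ^ k"
        unfolding e_def by (simp add: algebra_simps)
      also have "\<dots> \<le> 1 / 2 * (D / r n \<theta>) + 1 / 2 * (1 / 2) ^ k"
        by (intro add_mono mult_right_mono \<alpha>1 \<alpha>2) (use D r in auto)
      also have "E / r n \<theta> + (1 / 2 * (D / r n \<theta>) + 1 / 2 * (1 / 2) ^ k) = (E + D / 2) / r n \<theta> + (1 / 2) ^ Suc k"
        by (simp add: add_divide_distrib)
      also have "\<dots> \<le> D / r n \<theta> + (1 / 2) ^ Suc k"
        by (intro add_right_mono divide_right_mono D) (use r in auto)
      finally show ?thesis by simp
    qed
  qed
  show ?thesis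
  proof (intro exI[of _ D] allI impI ballI)
    fix n \<theta> assume n: "n0 \<le> n" and \<theta>: "\<theta> \<in> topspace (Theta n)"
    show "(SUP z. \<bar>\<P>(\<omega> in M n \<theta>. W n \<theta> \<omega> \<le> z) - Phi z\<bar>) \<le> D / r n \<theta>"
    proof (rule cSUP_least)
      fix z :: real
      \<comment> \<open>\<open>D\<close> does not depend on \<open>k\<close>, so the error vanishes
        as k tends to infinity.\<close>
      have "(\<lambda>k. D / r n \<theta> + (1 / 2) ^ k) \<longlonglongrightarrow> D / r n \<theta> + 0"
        by (intro tendsto_intros LIMSEQ_power_zero) auto
      then show "\<bar>\<P>(\<omega> in M n \<theta>. W n \<theta> \<omega> \<le> z) - Phi z\<bar> \<le> D / r n \<theta>"
        using bound[OF n \<theta>, of z] by (intro LIMSEQ_le_const) auto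
    qed simp
  qed
qed

end
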